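(* Consider the attack stage of the BVR differential game described in the context, in the one-on-one case where $R_1$ is the participating interceptor, and assume that $\mathbf{x}\in\mathcal{R}_R$. Then the optimal headings of $B_L$ and $R_1$ in the relative coordinate frame are given by the state-feedback policies $$\cos\theta_B^*=\frac{x^*}{\sqrt{x^{*2}+y^{*2}}},\qquad \sin\theta_B^*=\frac{y^*}{\sqrt{x^{*2}+y^{*2}}},$$ $$\cos\theta_1^*=\frac{x^*-x_1'}{\sqrt{(x^*-x_1')^2+y^{*2}}},\qquad \sin\theta_1^*=\frac{y^*}{\sqrt{(x^*-x_1')^2+y^{*2}}},$$ where $x^*=r^*\cos\theta^*$, $y^*=\zeta r^*\sin\theta^*$, $$\cos\theta^*=\frac{br^{*2}-2\beta\rho r^*-\eta}{2x_1'r^*},\qquad \sin\theta^*=\frac{\sqrt{4x_1'^2r^{*2}-[br^{*2}-2\beta\rho r^*-\eta]^2}}{2x_1'r^*}.$$ The optimal radius $r^*>0$ is the (positive real) solution of the sixth-order equation $$k_6r^6+k_5r^5+k_4r^4+k_3r^3+k_2r^2+k_1r+(\beta\rho\eta)^2=0$$ that minimizes the cost $$J(r)=d_s^2+r^2-\frac{d_s}{x_1'}\Big(c_\phi\,[(1-\beta^2)r^2-2\beta\rho r-\eta]+\zeta s_\phi\sqrt{4x_1'^2r^2-[(1-\beta^2)r^2-2\beta\rho r-\eta]^2}\Big),$$ where $$k_1=4\beta\rho\Big[\eta(\beta^2\rho^2-x_1'^2s_\phi^2)+\tfrac12\eta^2\Big(\tfrac{x_1'}{d_s}c_\phi-b\Big)\Big],$$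 $$k_2=2\beta^2\rho^2\Big[2\beta^2\rho^2-2x_1'^2(1+s_\phi^2)+\eta\Big(4\tfrac{x_1'}{d_s}c_\phi-5b\Big)\Big]+\eta^2\Big[b^2+\tfrac{x_1'}{d_s}\Big(\tfrac{x_1'}{d_s}-2p\Big)\Big]+4x_1'^2s_\phi^2(x_1'^2+b\eta),$$ $$k_3=4\beta\rho\Big(\beta^2\rho^2\Big(2\tfrac{x_1'}{d_s}c_\phi-3b\Big)+b\eta\Big(2b-3\tfrac{x_1'}{d_s}c_\phi\Big)+x_1'^2\Big[\tfrac{\eta}{d_s^2}+b(2+s_\phi^2)-2\tfrac{x_1'}{d_s}c_\phi\Big]\Big),$$ $$k_4=\beta^2\rho^2\Big[13b^2+4\tfrac{x_1'}{d_s}\Big(\tfrac{x_1'}{d_s}-4p\Big)\Big]-2(b\eta+2x_1'^2)\Big[b^2+\tfrac{x_1'}{d_s}\Big(\tfrac{x_1'}{d_s}-2p\Big)\Big],$$ $$k_5=-2b\beta\rho\Big[3b^2+\tfrac{x_1'}{d_s}\Big(2\tfrac{x_1'}{d_s}-5p\Big)\Big],$$ $$k_6=b^2\Big[b^2+\tfrac{x_1'}{d_s}\Big(\tfrac{x_1'}{d_s}-2p\Big)\Big],$$ with $b=1-\beta^2$, $\eta=\rho^2-x_1'^2$, $p=bc_\phi$.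
   Context: Attack-stage BVR (Beyond Visual Range) differential game. Players move in the plane: the blue leader $B_L$ at $(x_B,y_B)$ and red interceptors $R_1$ at $(x_1,y_1)$, $R_2$ at $(x_2,y_2)$; there is a static red asset $R_s=(x_s,y_s)$. Constants: $\rho_s>0$, $\rho>0$ (engagement ranges). Speeds are constant and normalized: $B_L$ has speed $1$ and the interceptors have speed $\beta>1$. The state $\mathbf{x}$ collects the players' coordinates, $\mathbf{x}=(x_B,y_B,x_1,y_1,x_2,y_2)$, with dynamics $\dot x_B=\cos\theta_B$, $\dot y_B=\sin\theta_B$, $\dot x_i=\beta\cos\theta_i$, $\dot y_i=\beta\sin\theta_i$, where the controls are the instantaneous headings in $[-\pi,\pi)$; $\theta_B$ is chosen by $B_L$ and the $\theta_i$ by the red team. The game terminates either when $\sqrt{(x_B-x_s)^2+(y_B-y_s)^2}=\rho_s$ ($B_L$ reaches the engagement zone of $R_s$, the closed disk $\Gamma$ of radius $\rho_s$ centered at $R_s$), or when some interceptor is at distance $\rho$ from $B_L$ ($B_L$ is blocked). $\mathcal{R}_R$ denotes the red team's winning subspace: the states from which, under optimal play, the game terminates with $B_L$ being blocked. On $\mathcal{R}_R$ the game terminates at the time $t_f$ of blocking, with terminal payoff $\sqrt{(x_B(t_f)-x_s)^2+(y_B(t_f)-y_s)^2}$, minimized by $B_L$ and maximized by the red team over state-feedback strategies. "Optimal" means saddle-point strategies of this zero-sum game. In the one-on-one case only the interceptor $R_1$ participates (against $B_L$). Relative coordinate frame: the translated and rotated frame in which $B_L=(0,0)$, $R_1=(x_1',0)$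 with $x_1'=\sqrt{(x_1-x_B)^2+(y_1-y_B)^2}>0$, and $R_s=(x_s',y_s')$, where $x_s'=d_s\cos\phi$, $y_s'=d_s\sin\phi$, $d_s=\sqrt{(x_s-x_B)^2+(y_s-y_B)^2}$, $\phi=\lambda_s-\lambda_1$, and $\lambda_s$, $\lambda_1$ are the polar angles of the vectors from $B_L$ to $R_s$ and from $B_L$ to $R_1$ (i.e. $\arctan\frac{y_s-y_B}{x_s-x_B}$ and $\arctan\frac{y_1-y_B}{x_1-x_B}$ taken in the correct quadrant). Notation: $\zeta=\mathrm{sign}(y_s')$, $c_\phi=\cos\phi$, $s_\phi=\sin\phi$. *)

theory Defs
  imports "HOL-Analysis.Analysis" "HOL-Library.Extended_Real"
begin

section \<open>The one-on-one blocking game\<close>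

text \<open>
  The plane is identified with the complex numbers.  A state of the one-on-one game is the pair
  \<open>(B, R)\<close> of the positions of the blue leader and of the participating interceptor.
  Throughout, \<open>\<beta>\<close> is the speed of the interceptor (the leader has speed 1), \<open>\<rho>\<close> the blocking range,
  \<open>\<rho>s\<close> the engagement range of the red asset and \<open>a\<close> the position of the red asset.
\<close>

type_synonym state = "complex \<times> complex"

type_synonym feedback = "state \<Rightarrow> real"

definition feedback_law :: "feedback \<Rightarrow> bool" where
  "feedback_law \<gamma> \<longleftrightarrow> (\<forall>x. \<gamma> x \<in> {-pi..<pi})"

definition playing :: "real \<Rightarrow> real \<Rightarrow> complex \<Rightarrow> state set" where
  "playing \<rho> \<rho>s a = {(B, R). dist B a > \<rho>s \<and> dist B R > \<rho>}"

definition terminal :: "real \<Rightarrow> real \<Rightarrow> complex \<Rightarrow> state set" where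
  "terminal \<rho> \<rho>s a = {(B, R). dist B a = \<rho>s \<or> dist B R = \<rho>}"

text \<open>If both termination conditions are met at once, the leader has reached the engagement zone.\<close>

definition blocked :: "real \<Rightarrow> real \<Rightarrow> complex \<Rightarrow> state set" where
  "blocked \<rho> \<rho>s a = {(B, R). dist B R = \<rho> \<and> dist B a > \<rho>s}"

text \<open>
  Feedback laws need not be continuous, so the dynamics are understood in integrated form
  (Caratheodory solutions).  Continuity of \<open>z\<close> and \<open>z 0 = x\<close> are consequences.
\<close>

definition follows :: "real \<Rightarrow> feedback \<Rightarrow> feedback \<Rightarrow> state \<Rightarrow> (real \<Rightarrow> state) \<Rightarrow> real set \<Rightarrow> bool" where
  "follows \<beta> \<gamma>B \<gamma>R x z I \<longleftrightarrow> (\<forall>t\<in>I.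
     ((\<lambda>s. cis (\<gamma>B (z s))) has_integral (fst (z t) - fst x)) {0..t} \<and>
     ((\<lambda>s. of_real \<beta> * cis (\<gamma>R (z s))) has_integral (snd (z t) - snd x)) {0..t})"

definition terminating_play ::
  "real \<Rightarrow> real \<Rightarrow> real \<Rightarrow> complex \<Rightarrow> feedback \<Rightarrow> feedback \<Rightarrow> state \<Rightarrow> (real \<Rightarrow> state) \<Rightarrow> real \<Rightarrow> bool" where
  "terminating_play \<beta> \<rho> \<rho>s a \<gamma>B \<gamma>R x z tf \<longleftrightarrow>
     0 \<le> tf \<and> follows \<beta> \<gamma>B \<gamma>R x z {0..tf} \<and>
     (\<forall>t\<in>{0..<tf}. z t \<in> playing \<rho> \<rho>s a) \<and> z tf \<in> terminal \<rho> \<rho>s a"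

definition endless_play ::
  "real \<Rightarrow> real \<Rightarrow> real \<Rightarrow> complex \<Rightarrow> feedback \<Rightarrow> feedback \<Rightarrow> state \<Rightarrow> (real \<Rightarrow> state) \<Rightarrow> bool" where
  "endless_play \<beta> \<rho> \<rho>s a \<gamma>B \<gamma>R x z \<longleftrightarrow>
     follows \<beta> \<gamma>B \<gamma>R x z {0..} \<and> (\<forall>t\<ge>0. z t \<in> playing \<rho> \<rho>s a)"

text \<open>
  The payoff is the terminal distance between the leader and the asset; it equals \<open>\<rho>s\<close>, the least
  possible value, on plays in which the leader reaches the engagement zone.  In an endless play the
  leader never reaches the zone; it counts as \<open>\<infinity>\<close> for the minimizing leader.  A pair of laws may
  generate several plays, or none, hence a set of payoffs.
\<close>

definition payoffs ::
  "real \<Rightarrow> real \<Rightarrow> real \<Rightarrow> complex \<Rightarrow> feedback \<Rightarrow> feedback \<Rightarrow> state \<Rightarrow> ereal set" where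
  "payoffs \<beta> \<rho> \<rho>s a \<gamma>B \<gamma>R x =
     {ereal (dist (fst (z tf)) a) | z tf. terminating_play \<beta> \<rho> \<rho>s a \<gamma>B \<gamma>R x z tf} \<union>
     {\<infinity> | z. endless_play \<beta> \<rho> \<rho>s a \<gamma>B \<gamma>R x z}"

text \<open>
  Saddle-point laws are required to yield continuous velocity fields.  This guarantees that any two of
  them generate plays from every state (so that the value does not depend on the saddle point), and it
  makes the value of a law at a single state meaningful.  Headings themselves may jump between
  \<open>-\<pi>\<close> and \<open>\<pi>\<close>, whence \<open>cis\<close>.  Unilateral deviations range over all feedback laws.
\<close>

definition regular_law :: "real \<Rightarrow> real \<Rightarrow> complex \<Rightarrow> feedback \<Rightarrow> bool" where
  "regular_law \<rho> \<rho>s a \<gamma> \<longleftrightarrow>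
     feedback_law \<gamma> \<and> continuous_on (playing \<rho> \<rho>s a) (\<lambda>x. cis (\<gamma> x))"

definition saddle_point ::
  "real \<Rightarrow> real \<Rightarrow> real \<Rightarrow> complex \<Rightarrow> feedback \<Rightarrow> feedback \<Rightarrow> state \<Rightarrow> bool" where
  "saddle_point \<beta> \<rho> \<rho>s a \<gamma>B \<gamma>R x \<longleftrightarrow>
     regular_law \<rho> \<rho>s a \<gamma>B \<and> regular_law \<rho> \<rho>s a \<gamma>R \<and>
     (\<exists>v. payoffs \<beta> \<rho> \<rho>s a \<gamma>B \<gamma>R x = {v} \<and>
        (\<forall>\<gamma>. feedback_law \<gamma> \<longrightarrow> (\<forall>w\<in>payoffs \<beta> \<rho> \<rho>s a \<gamma> \<gamma>R x. v \<le> w)) \<and>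
        (\<forall>\<gamma>. feedback_law \<gamma> \<longrightarrow> (\<forall>w\<in>payoffs \<beta> \<rho> \<rho>s a \<gamma>B \<gamma> x. w \<le> v)))"

definition red_winning :: "real \<Rightarrow> real \<Rightarrow> real \<Rightarrow> complex \<Rightarrow> state set" where
  "red_winning \<beta> \<rho> \<rho>s a = {x \<in> playing \<rho> \<rho>s a.
     \<exists>\<gamma>B \<gamma>R. saddle_point \<beta> \<rho> \<rho>s a \<gamma>B \<gamma>R x \<and>
       (\<exists>z tf. terminating_play \<beta> \<rho> \<rho>s a \<gamma>B \<gamma>R x z tf \<and> z tf \<in> blocked \<rho> \<rho>s a)}"


section \<open>The relative coordinate frame\<close>

definition rel_x1 :: "state \<Rightarrow> real" where
  "rel_x1 x = (case x of (B, R) \<Rightarrow> dist R B)"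

definition asset_dist :: "complex \<Rightarrow> state \<Rightarrow> real" where
  "asset_dist a x = (case x of (B, R) \<Rightarrow> dist a B)"

definition los_angle :: "state \<Rightarrow> real" where
  "los_angle x = (case x of (B, R) \<Rightarrow> Arg (R - B))"

definition rel_angle :: "complex \<Rightarrow> state \<Rightarrow> real" where
  "rel_angle a x = (case x of (B, R) \<Rightarrow> Arg (a - B) - los_angle x)"

definition asset_side :: "complex \<Rightarrow> state \<Rightarrow> real" where
  "asset_side a x = sgn (asset_dist a x * sin (rel_angle a x))"


section \<open>The candidate radius\<close>

definition quad :: "real \<Rightarrow> real \<Rightarrow> state \<Rightarrow> real \<Rightarrow> real" where
  "quad \<beta> \<rho> x r = (1 - \<beta>^2) * r^2 - 2 * \<beta> * \<rho> * r - (\<rho>^2 - (rel_x1 x)^2)"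

definition radicand :: "real \<Rightarrow> real \<Rightarrow> state \<Rightarrow> real \<Rightarrow> real" where
  "radicand \<beta> \<rho> x r = 4 * (rel_x1 x)^2 * r^2 - (quad \<beta> \<rho> x r)^2"

definition cost :: "real \<Rightarrow> real \<Rightarrow> complex \<Rightarrow> state \<Rightarrow> real \<Rightarrow> real" where
  "cost \<beta> \<rho> a x r = (asset_dist a x)^2 + r^2
     - asset_dist a x / rel_x1 x *
       (cos (rel_angle a x) * quad \<beta> \<rho> x r
        + asset_side a x * sin (rel_angle a x) * sqrt (radicand \<beta> \<rho> x r))"

definition sextic :: "real \<Rightarrow> real \<Rightarrow> complex \<Rightarrow> state \<Rightarrow> real \<Rightarrow> real" where
  "sextic \<beta> \<rho> a x r =
    (let X = rel_x1 x; d = asset_dist a x;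
         c = cos (rel_angle a x); s = sin (rel_angle a x);
         b = 1 - \<beta>^2; \<eta> = \<rho>^2 - X^2; p = b * c;
         k1 = 4 * \<beta> * \<rho> * (\<eta> * (\<beta>^2 * \<rho>^2 - X^2 * s^2) + 1/2 * \<eta>^2 * (X/d * c - b));
         k2 = 2 * \<beta>^2 * \<rho>^2 * (2 * \<beta>^2 * \<rho>^2 - 2 * X^2 * (1 + s^2) + \<eta> * (4 * (X/d) * c - 5 * b))
              + \<eta>^2 * (b^2 + X/d * (X/d - 2 * p)) + 4 * X^2 * s^2 * (X^2 + b * \<eta>);
         k3 = 4 * \<beta> * \<rho> * (\<beta>^2 * \<rho>^2 * (2 * (X/d) * c - 3 * b)
              + b * \<eta> * (2 * b - 3 * (X/d) * c)
              + X^2 * (\<eta> / d^2 + b * (2 + s^2) - 2 * (X/d) * c));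
         k4 = \<beta>^2 * \<rho>^2 * (13 * b^2 + 4 * (X/d) * (X/d - 4 * p))
              - 2 * (b * \<eta> + 2 * X^2) * (b^2 + X/d * (X/d - 2 * p));
         k5 = - 2 * b * \<beta> * \<rho> * (3 * b^2 + X/d * (2 * (X/d) - 5 * p));
         k6 = b^2 * (b^2 + X/d * (X/d - 2 * p))
     in k6 * r^6 + k5 * r^5 + k4 * r^4 + k3 * r^3 + k2 * r^2 + k1 * r + (\<beta> * \<rho> * \<eta>)^2)"

text \<open>
  The cost is a real number only where the radicand is nonnegative (HOL's \<open>sqrt\<close> is total), so the
  minimum is taken over those positive roots.
\<close>

definition optimal_radius :: "real \<Rightarrow> real \<Rightarrow> complex \<Rightarrow> state \<Rightarrow> real \<Rightarrow> bool" where
  "optimal_radius \<beta> \<rho> a x r \<longleftrightarrow>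
     is_arg_min (cost \<beta> \<rho> a x)
       (\<lambda>r. r > 0 \<and> radicand \<beta> \<rho> x r \<ge> 0 \<and> sextic \<beta> \<rho> a x r = 0) r"

end

theory Submission
  imports Defs
begin

text \<open>
  The leader can safely reach exactly the points \<open>P\<close> with \<open>\<beta> |P - B| + \<rho> \<le> |P - R|\<close>, a convex region
  bounded by a branch of a Cartesian oval.  Let \<open>P\<close> be the point of this region closest to the asset
  and let \<open>V\<close> be its distance to the asset.  If the leader heads for \<open>P\<close>, then \<open>V\<close> never increases,
  whatever the interceptor does, and the leader approaches the asset at a positive rate, so that the
  play ends; if the interceptor heads for \<open>P\<close>, then \<open>V\<close> never decreases.  At blocking \<open>V\<close> is the
  payoff, hence the two homing laws form a saddle point with value \<open>V\<close> wherever \<open>V > \<rho>s\<close>.  A regular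
  law that starts in another direction loses \<open>V\<close> at once against the opponent's homing law, so every
  saddle point has these headings.  In the relative frame, \<open>P\<close> has polar radius \<open>r\<^sup>*\<close>, the cost is the
  squared distance from a point of the oval to the asset, and the condition that the normal of the oval
  at \<open>P\<close> points to the asset becomes the sextic equation.
\<close>

section \<open>Monotonicity criterion and the Cauchy--Peano theorem\<close>

text \<open>The obstacle is that the opponent's feedback law is arbitrary: its velocity is known
  only through an integral equation, so \<open>miss\<close> need not be differentiable along a play.
  Only the homing player's velocity field is known to be continuous; for monotonicity, the opponent
  enters through its speed bound alone. Nor is \<open>miss\<close> itself ever differentiated. Its
  changes are read off from the slack in the inequality that defines the safe region: a deficit e
  can be repaired at cost e / (\<beta> - 1) (\<open>miss_le_near\<close>), and a surplus e gains at
  least e / (\<beta> + 1) unless the asset itself becomes safe (\<open>miss_le_deep\<close>). The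
  two players are not treated symmetrically: an upper bound for the later \<open>miss\<close> tests
  the present aim point at the later time, a lower bound tests the later aim point at the present
  time, so the interceptor's estimates also rest on the continuity of \<open>aim\<close> along the
  play. To refute a wrong heading, a play of the given law against the homing law must exist; the
  fields are continuous but not assumed Lipschitz, hence Peano's theorem.\<close>

lemma antimono_from_upper_slope:
  fixes f :: "real \<Rightarrow> real"
  assumes "s \<le> T" and cont: "continuous_on {s..T} f"
    and slope: "\<And>t e. s \<le> t \<Longrightarrow> t < T \<Longrightarrow> e > 0 \<Longrightarrow>
      eventually (\<lambda>h. f (t + h) \<le> f t + e * h) (at_right 0)"
  shows "f T \<le> f s"
proof (rule field_le_epsilon)
  fix e' :: real assume "e' > 0"
  define e where "e = e' / (T - s + 1)"
  have "e > 0" using \<open>e' > 0\<close> \<open>s \<le> T\<close> by (simp add: e_def)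
  \<comment> \<open>The times up to which the bound with slope e holds form a compact set; if its
    maximum m were below T, the slope hypothesis at m would produce a later member.\<close>
  define S where "S = {t \<in> {s..T}. f t \<le> f s + e * (t - s)}"
  have "closed S"
    unfolding S_def by (intro continuous_on_closed_Collect_le continuous_intros cont closed_real_atLeastAtMost)
  moreover have "bounded S"
    by (rule bounded_subset[of "{s..T}"]) (auto simp: S_def)
  ultimately have "compact S"
    by (simp add: compact_eq_bounded_closed)
  moreover have "s \<in> S" using \<open>s \<le> T\<close> by (simp add: S_def)
  ultimately obtain m where m: "m \<in> S" "\<And>t. t \<in> S \<Longrightarrow> t \<le> m"
    using compact_attains_sup[of S] by blast
  have "m = T"
  proof (rule ccontr)
    assume "m \<noteq> T"
    then have "m < T" "s \<le> m" using m(1) by (auto simp: S_def)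
    from slope[OF this(2,1) \<open>e > 0\<close>] obtain d where "d > 0"
      and d: "\<And>h. 0 < h \<Longrightarrow> h < d \<Longrightarrow> f (m + h) \<le> f m + e * h"
      unfolding eventually_at_right_field by auto
    define h where "h = min (d / 2) (T - m)"
    have h: "0 < h" "h < d" "m + h \<le> T" using \<open>d > 0\<close> \<open>m < T\<close> by (auto simp: h_def)
    have "f (m + h) \<le> f s + e * (m + h - s)"
      using d[OF h(1,2)] m(1) by (auto simp: S_def algebra_simps)
    then have "m + h \<in> S" using h \<open>s \<le> m\<close> by (simp add: S_def)
    with m(2) h(1) show False by force
  qed
  with m(1) have "f T \<le> f s + e * (T - s)" by (simp add: S_def)
  also have "e * (T - s) \<le> e'"
    using \<open>s \<le> T\<close> \<open>e' > 0\<close> by (simp add: e_def divide_simps mult_left_mono)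
  finally show "f T \<le> f s + e'" by simp
qed

section \<open>Euler polygons and existence of solutions\<close>

primrec euler :: "('a::real_vector \<Rightarrow> 'a) \<Rightarrow> 'a \<Rightarrow> real \<Rightarrow> nat \<Rightarrow> 'a" where
  "euler f x h 0 = x"
| "euler f x h (Suc k) = euler f x h k + h *\<^sub>R f (euler f x h k)"

text \<open>Serves twice: with v = 0 and e = M it gives the Lipschitz bound for the polygon, with v
  the velocity at a limit state it gives the derivative there.\<close>

lemma euler_increment:
  fixes f :: "'a::real_normed_vector \<Rightarrow> 'a"
  assumes "m \<le> k" "0 \<le> h" "\<And>j. m \<le> j \<Longrightarrow> j < k \<Longrightarrow> norm (f (euler f x h j) - v) \<le> e"
  shows "norm (euler f x h k - euler f x h m - ((real k - real m) * h) *\<^sub>R v) \<le> (real k - real m) * h * e"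
  using assms(1,3)
proof (induction k rule: dec_induct)
  case base
  then show ?case by simp
next
  case (step k)
  let ?y = "euler f x h"
  have "?y (Suc k) - ?y m - ((real (Suc k) - real m) * h) *\<^sub>R v
      = (?y k - ?y m - ((real k - real m) * h) *\<^sub>R v) + h *\<^sub>R (f (?y k) - v)"
    by (simp add: algebra_simps)
  also have "norm \<dots> \<le> (real k - real m) * h * e + h * e"
    using step.IH step.prems step.hyps \<open>0 \<le> h\<close>
    by (intro norm_triangle_mono) (auto intro!: mult_left_mono)
  finally show ?case by (simp add: algebra_simps)
qed

text \<open>
  The solution is a cluster point of the Euler step functions in the product topology; Tychonoff's
  theorem replaces the theorem of Arzela and Ascoli and gives all of \<open>[0, \<infinity>)\<close> at once.
\<close>

lemma cauchy_peano:
  fixes f :: "'a::euclidean_space \<Rightarrow> 'a"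
  assumes "open U" and contf: "continuous_on U f" and bound: "\<And>x. norm (f x) \<le> M"
  obtains z where "z 0 = x0"
    and "\<And>s t. 0 \<le> s \<Longrightarrow> s \<le> t \<Longrightarrow> dist (z s) (z t) \<le> M * (t - s)"
    and "\<And>t. 0 < t \<Longrightarrow> z t \<in> U \<Longrightarrow> (z has_vector_derivative f (z t)) (at t)"
proof -
  have "M \<ge> 0" using norm_ge_zero order_trans bound by blast
  define H :: "nat \<Rightarrow> real" where "H n = inverse (real (Suc n))" for n
  \<comment> \<open>\<open>K n t\<close> counts completed Euler steps, so \<open>Z n\<close> is a
    step function and is Lipschitz only up to an error of one step \<open>H n\<close>, which
    vanishes in the limit.\<close>
  define K where "K n t = nat \<lfloor>t / H n\<rfloor>" for n t
  define Y where "Y n = euler f x0 (H n)" for n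
  define Z where "Z n t = Y n (K n t)" for n t
  have H: "0 < H n" for n by (simp add: H_def)
  have K: "K n s \<le> K n t" "\<bar>(real (K n t) - real (K n s)) * H n - (t - s)\<bar> \<le> H n"
    if "0 \<le> s" "s \<le> t" for n s t
  proof -
    show "K n s \<le> K n t"
      using that H[of n] unfolding K_def by (intro nat_mono floor_mono divide_right_mono) auto
    have r: "real (K n u) = of_int \<lfloor>u / H n\<rfloor>" if "0 \<le> u" for u
      using that H[of n] by (simp add: K_def)
    have fl: "real_of_int \<lfloor>u / H n\<rfloor> * H n \<le> u" "u \<le> real_of_int \<lfloor>u / H n\<rfloor> * H n + H n" for u
    proof -
      have "real_of_int \<lfloor>u / H n\<rfloor> \<le> u / H n" "u / H n \<le> real_of_int \<lfloor>u / H n\<rfloor> + 1"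
        by linarith+
      then show "real_of_int \<lfloor>u / H n\<rfloor> * H n \<le> u" "u \<le> real_of_int \<lfloor>u / H n\<rfloor> * H n + H n"
        by (simp_all only: pos_le_divide_eq[OF H] pos_divide_le_eq[OF H] distrib_right mult_1_left)
    qed
    have "t - s - H n \<le> (real_of_int \<lfloor>t / H n\<rfloor> - real_of_int \<lfloor>s / H n\<rfloor>) * H n"
      "(real_of_int \<lfloor>t / H n\<rfloor> - real_of_int \<lfloor>s / H n\<rfloor>) * H n \<le> t - s + H n"
      using fl[of t] fl[of s] by (auto simp: left_diff_distrib)
    then show "\<bar>(real (K n t) - real (K n s)) * H n - (t - s)\<bar> \<le> H n"
      using r that by auto
  qed
  have Y_lip: "dist (Y n k) (Y n m) \<le> M * ((real k - real m) * H n)" if "m \<le> k" for n m k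
    using euler_increment[of m k "H n" f x0 0 M] that bound H[of n]
    by (simp add: Y_def dist_norm mult.commute less_imp_le)
  have Z_lip: "dist (Z n s) (Z n t) \<le> M * (t - s + H n)" if "0 \<le> s" "s \<le> t" for n s t
  proof -
    have "dist (Z n s) (Z n t) \<le> M * ((real (K n t) - real (K n s)) * H n)"
      unfolding Z_def by (subst dist_commute) (rule Y_lip[OF K(1)[OF that]])
    also have "\<dots> \<le> M * (t - s + H n)"
      using K(2)[OF that, of n] \<open>M \<ge> 0\<close> by (intro mult_left_mono) auto
    finally show ?thesis .
  qed
  have Z0: "Z n 0 = x0" for n by (simp add: Z_def K_def Y_def)
  \<comment> \<open>The summand 1 absorbs the one-step error, since \<open>H n\<close> is at most
    1.\<close>
  define S where "S = PiE UNIV (\<lambda>t::real. cball x0 (M * (\<bar>t\<bar> + 1)))"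
  have Z_in: "Z n \<in> S" for n
  proof -
    have "dist x0 (Z n t) \<le> M * (\<bar>t\<bar> + 1)" for t
    proof (cases "0 \<le> t")
      case True
      have "dist x0 (Z n t) \<le> M * (t + H n)"
        using Z_lip[of 0 t n] True by (simp add: Z0)
      also have "\<dots> \<le> M * (\<bar>t\<bar> + 1)"
        using \<open>M \<ge> 0\<close> True by (intro mult_left_mono) (auto simp: H_def inverse_le_1_iff)
      finally show ?thesis .
    next
      case False
      then have "Z n t = x0" using H[of n] by (simp add: Z_def K_def Y_def divide_neg_pos)
      then show ?thesis using \<open>M \<ge> 0\<close> by simp
    qed
    then show ?thesis by (auto simp: S_def)
  qed
  have "compactin (product_topology (\<lambda>_::real. euclidean) UNIV) S"
    unfolding S_def by (subst compactin_PiE) simp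
  then have "compact S" by (simp add: euclidean_product_topology)
  moreover have "filtermap Z sequentially \<noteq> bot" by (simp add: filtermap_bot_iff)
  moreover have "eventually (\<lambda>x. x \<in> S) (filtermap Z sequentially)"
    by (simp add: eventually_filtermap Z_in)
  ultimately obtain z where z: "inf (nhds z) (filtermap Z sequentially) \<noteq> bot"
    unfolding compact_filter by blast
  \<comment> \<open>A basic neighbourhood in the product topology constrains finitely many times.
    Two are enough, because the Lipschitz bound and the difference quotient each compare two
    times.\<close>
  have cluster: "\<exists>n. H n < e \<and> dist (Z n s) (z s) < e \<and> dist (Z n t) (z t) < e" if "e > 0" for s t e
  proof (rule ccontr)
    assume none: "\<not> ?thesis"
    define V where "V = {y. dist (y s) (z s) < e \<and> dist (y t) (z t) < e}"
    have "open V"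
      unfolding V_def
      by (intro open_Collect_conj open_Collect_less continuous_intros
          continuous_on_product_coordinates)
    then have "eventually (\<lambda>y. y \<in> V) (nhds z)"
      by (rule eventually_nhds_in_open) (simp add: V_def \<open>e > 0\<close>)
    moreover have "eventually (\<lambda>n. H n < e) sequentially"
      unfolding H_def using \<open>e > 0\<close> by (intro order_tendstoD[OF LIMSEQ_inverse_real_of_nat]) 
    then have "eventually (\<lambda>y. y \<notin> V) (filtermap Z sequentially)"
      unfolding eventually_filtermap
      by (rule eventually_mono) (use none in \<open>auto simp: V_def\<close>)
    ultimately have "eventually (\<lambda>y. False) (inf (nhds z) (filtermap Z sequentially))"
      unfolding eventually_inf by blast
    then show False using z by (simp add: eventually_False)
  qed
  show thesis
  proof
    have "dist x0 (z 0) < e" if "e > 0" for e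
      using cluster[OF that, of 0 0] by (auto simp: Z0)
    then show "z 0 = x0" by (metis less_irrefl zero_less_dist_iff)
    show "dist (z s) (z t) \<le> M * (t - s)" if "0 \<le> s" "s \<le> t" for s t
    proof (rule field_le_epsilon)
      fix e :: real assume "e > 0"
      define e' where "e' = e / (M + 2)"
      have "e' > 0" and e': "(M + 2) * e' = e" using \<open>e > 0\<close> \<open>M \<ge> 0\<close> by (simp_all add: e'_def)
      from cluster[OF this(1), of s t] obtain n where
        n: "H n < e'" "dist (Z n s) (z s) < e'" "dist (Z n t) (z t) < e'" by blast
      have "dist (z s) (z t) \<le> dist (Z n s) (Z n t) + 2 * e'"
        using n dist_triangle[of "z s" "z t" "Z n s"] dist_triangle[of "Z n s" "z t" "Z n t"]
        by (simp add: dist_commute)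
      also have "\<dots> \<le> M * (t - s + e') + 2 * e'"
        using Z_lip[OF that, of n] n(1) \<open>M \<ge> 0\<close> mult_left_mono[of "t - s + H n" "t - s + e'" M] by simp
      also have "\<dots> = M * (t - s) + e"
        using e' by (simp add: algebra_simps)
      finally show "dist (z s) (z t) \<le> M * (t - s) + e" .
    qed
    show "(z has_vector_derivative f (z t0)) (at t0)" if "0 < t0" "z t0 \<in> U" for t0
      unfolding has_vector_derivative_def has_derivative_at_alt
    proof (intro conjI allI impI)
      show "bounded_linear (\<lambda>h. h *\<^sub>R f (z t0))" by (rule bounded_linear_scaleR_left)
      fix \<epsilon> :: real assume "\<epsilon> > 0"
      define v where "v = f (z t0)"
      have "continuous (at (z t0)) f"
        using \<open>open U\<close> contf that(2) by (simp add: continuous_on_eq_continuous_at)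
      then obtain r where "r > 0" and r: "\<And>y. dist y (z t0) < r \<Longrightarrow> norm (f y - v) < \<epsilon>"
        using \<open>\<epsilon> > 0\<close> unfolding continuous_at_eps_delta v_def by (auto simp: dist_norm)
      \<comment> \<open>The distance budget is \<open>4 * M + 1\<close> in units of \<delta>:
        \<open>1 + 2 * M\<close> from the limit state to \<open>Z n s\<close>, and
        \<open>2 * M\<close> more along the polygon. The bound by \<open>t0\<close> keeps all times
        nonnegative.\<close>
      define \<delta> where "\<delta> = min t0 (r / (4 * M + 1 + 1))"
      have "\<delta> > 0" using \<open>r > 0\<close> \<open>M \<ge> 0\<close> that(1) by (simp add: \<delta>_def)
      have \<delta>: "(4 * M + 1) * \<delta> < r"
      proof -
        have "(4 * M + 1) * \<delta> < (4 * M + 1 + 1) * \<delta>" using \<open>\<delta> > 0\<close> by simp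
        also have "\<dots> \<le> r"
          using \<open>M \<ge> 0\<close> pos_le_divide_eq[of "4 * M + 1 + 1" \<delta> r] by (simp add: \<delta>_def mult.commute)
        finally show ?thesis .
      qed
      have est: "norm (z t - z s - (t - s) *\<^sub>R v) \<le> \<epsilon> * (t - s)"
        if st: "0 \<le> s" "s \<le> t" "t - s < \<delta>" "s = t0 \<or> t = t0" for s t
      proof (rule field_le_epsilon)
        fix e :: real assume "e > 0"
        \<comment> \<open>In the factor \<open>2 + \<epsilon> + norm v\<close>, the 2 pays for
          replacing z by \<open>Z n\<close> at both times; \<epsilon> and \<open>norm v\<close> pay
          for the difference between the elapsed Euler time and \<open>t - s\<close>.\<close>
        define e' where "e' = min \<delta> (e / (2 + \<epsilon> + norm v))"
        have "e' > 0" using \<open>e > 0\<close> \<open>\<epsilon> > 0\<close> \<open>\<delta> > 0\<close>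
          by (simp add: e'_def add_pos_nonneg)
        have e': "(2 + \<epsilon> + norm v) * e' \<le> e"
          using \<open>\<epsilon> > 0\<close> pos_le_divide_eq[of "2 + \<epsilon> + norm v" e' e]
          by (simp add: e'_def mult.commute add_pos_nonneg)
        from cluster[OF \<open>e' > 0\<close>, of s t] obtain n where
          n: "H n < e'" "dist (Z n s) (z s) < e'" "dist (Z n t) (z t) < e'" by blast
        have "H n < \<delta>" using n(1) by (simp add: e'_def)
        have step: "M * (t - s + H n) \<le> 2 * M * \<delta>"
          using mult_left_mono[of "t - s + H n" "2 * \<delta>" M] \<open>M \<ge> 0\<close> st(3) \<open>H n < \<delta>\<close> by simp
        have near: "dist (Z n s) (z t0) \<le> \<delta> + 2 * M * \<delta>"
        proof (cases "s = t0")
          case True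
          then show ?thesis using n(2) \<open>M \<ge> 0\<close> \<open>\<delta> > 0\<close> by (simp add: e'_def add_increasing2)
        next
          case False
          then have "t = t0" using st(4) by simp
          then show ?thesis
            using n(3) Z_lip[OF st(1,2), of n] step dist_triangle[of "Z n s" "z t0" "Z n t"]
            by (simp add: e'_def)
        qed
        have "norm (f (Y n j) - v) \<le> \<epsilon>" if "K n s \<le> j" "j < K n t" for j
        proof -
          have "dist (Y n j) (Z n s) \<le> M * ((real j - real (K n s)) * H n)"
            unfolding Z_def by (rule Y_lip[OF that(1)])
          also have "\<dots> \<le> M * ((real (K n t) - real (K n s)) * H n)"
            using that \<open>M \<ge> 0\<close> H[of n] by (intro mult_left_mono mult_right_mono) auto
          also have "\<dots> \<le> M * (t - s + H n)"
            using K(2)[OF st(1,2), of n] \<open>M \<ge> 0\<close> by (intro mult_left_mono) auto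
          finally have "dist (Y n j) (z t0) \<le> (4 * M + 1) * \<delta>"
            using step near dist_triangle[of "Y n j" "z t0" "Z n s"] by (simp add: algebra_simps)
          with \<delta> r show ?thesis by (meson less_imp_le order_le_less_trans)
        qed
        then have inc: "norm (Z n t - Z n s - ((real (K n t) - real (K n s)) * H n) *\<^sub>R v)
            \<le> (real (K n t) - real (K n s)) * H n * \<epsilon>"
          unfolding Z_def Y_def
          by (intro euler_increment K(1) st(1,2)) (use H[of n] in auto)
        let ?D = "(real (K n t) - real (K n s)) * H n"
        have "z t - z s - (t - s) *\<^sub>R v
            = (Z n t - Z n s - ?D *\<^sub>R v) + (z t - Z n t) + (Z n s - z s) + (?D - (t - s)) *\<^sub>R v"
          by (simp add: algebra_simps)
        also have "norm \<dots> \<le> ?D * \<epsilon> + e' + e' + e' * norm v"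
          using inc n K(2)[OF st(1,2), of n]
          by (intro norm_triangle_mono) (auto simp: dist_norm norm_minus_commute intro!: mult_right_mono)
        also have "\<dots> \<le> (t - s + e') * \<epsilon> + e' + e' + e' * norm v"
          using K(2)[OF st(1,2), of n] n(1) \<open>\<epsilon> > 0\<close> mult_right_mono[of ?D "t - s + e'" \<epsilon>] by simp
        also have "\<dots> \<le> \<epsilon> * (t - s) + e"
          using e' by (simp add: algebra_simps)
        finally show "norm (z t - z s - (t - s) *\<^sub>R v) \<le> \<epsilon> * (t - s) + e" .
      qed
      have "norm (z y - z t0 - (y - t0) *\<^sub>R v) \<le> \<epsilon> * norm (y - t0)" if y: "norm (y - t0) < \<delta>" for y
      proof (cases "t0 \<le> y")
        case True
        then show ?thesis using est[of t0 y] y \<open>0 < t0\<close> by simp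
      next
        case False
        then have "norm (z t0 - z y - (t0 - y) *\<^sub>R v) \<le> \<epsilon> * (t0 - y)"
          using y by (intro est) (auto simp: \<delta>_def)
        moreover have "z y - z t0 - (y - t0) *\<^sub>R v = - (z t0 - z y - (t0 - y) *\<^sub>R v)"
          by (simp add: algebra_simps)
        ultimately show ?thesis using False by (simp only: norm_minus_cancel) simp
      qed
      then show "\<exists>d>0. \<forall>y. norm (y - t0) < d \<longrightarrow>
          norm (z y - z t0 - (y - t0) *\<^sub>R f (z t0)) \<le> \<epsilon> * norm (y - t0)"
        using \<open>\<delta> > 0\<close> unfolding v_def by blast
    qed
  qed
qed

section \<open>The safe region and the homing laws\<close>

text \<open>\<open>Arg\<close> ranges over angles above -\<pi> up to and including \<pi>, headings
  over angles from -\<pi> to below \<pi>; the single value \<pi> is moved to -\<pi>, which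
  \<open>cis\<close> does not notice.\<close>

definition heading :: "complex \<Rightarrow> real" where
  "heading v = (if Arg v = pi then - pi else Arg v)"

lemma heading_range: "heading v \<in> {-pi..<pi}"
  using Arg_bounded[of v] by (auto simp: heading_def)

lemma cis_heading: "v \<noteq> 0 \<Longrightarrow> cis (heading v) = sgn v"
  using cis_Arg[of v] by (auto simp: heading_def simp flip: cis_inverse)

locale blocking_game =
  fixes \<beta> \<rho> \<rho>s :: real and a :: complex
  assumes speed: "\<beta> > 1" and range: "\<rho> > 0" and zone: "\<rho>s > 0"
begin

definition safe :: "state \<Rightarrow> complex set" where
  "safe x = {P. \<beta> * dist (fst x) P + \<rho> \<le> dist (snd x) P}"

text \<open>Separation exactly \<rho> is included, so that \<open>aim\<close> and
  \<open>miss\<close> are controlled up to the moment of blocking.\<close>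

definition apart :: "state set" where
  "apart = {x. \<rho> \<le> dist (fst x) (snd x)}"

definition aim :: "state \<Rightarrow> complex" where
  "aim x = closest_point (safe x) a"

definition miss :: "state \<Rightarrow> real" where
  "miss x = dist a (aim x)"

abbreviation play_states :: "state set" where
  "play_states \<equiv> playing \<rho> \<rho>s a"

section \<open>Geometry of the safe region\<close>

lemma play_states_iff: "x \<in> play_states \<longleftrightarrow> \<rho>s < dist (fst x) a \<and> \<rho> < dist (fst x) (snd x)"
  by (cases x) (simp add: playing_def)

lemma play_states_apart: "x \<in> play_states \<Longrightarrow> x \<in> apart"
  by (simp add: play_states_iff apart_def)

lemma open_play_states: "open play_states"
proof -
  have "play_states = {x. \<rho>s < dist (fst x) a \<and> \<rho> < dist (fst x) (snd x)}"
    using play_states_iff by blast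
  moreover have "open \<dots>"
    by (intro open_Collect_conj open_Collect_less continuous_intros)
  ultimately show ?thesis by simp
qed

text \<open>The defining inequality involves a difference of norms, which hides convexity. Squaring
  cancels one square of the leader's distance and leaves on the left a sum of convex functions of P:
  a quadratic with coefficient \<open>\<beta>\<^sup>2 - 1\<close>, a norm and a linear term.\<close>

lemma safe_iff:
  "P \<in> safe x \<longleftrightarrow> (\<beta>\<^sup>2 - 1) * (norm (P - fst x))\<^sup>2 + 2 * \<beta> * \<rho> * norm (P - fst x)
     + 2 * ((P - fst x) \<bullet> (snd x - fst x)) \<le> (dist (fst x) (snd x))\<^sup>2 - \<rho>\<^sup>2"
proof -
  define u where "u = P - fst x"
  define w where "w = snd x - fst x"
  have "P \<in> safe x \<longleftrightarrow> \<beta> * norm u + \<rho> \<le> norm (u - w)"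
    by (simp add: safe_def u_def w_def dist_norm norm_minus_commute)
  also have "\<dots> \<longleftrightarrow> (\<beta> * norm u + \<rho>)\<^sup>2 \<le> (norm (u - w))\<^sup>2"
    using speed range by simp
  also have "(norm (u - w))\<^sup>2 = (norm u)\<^sup>2 - 2 * (u \<bullet> w) + (norm w)\<^sup>2"
    by (simp add: power2_norm_eq_inner algebra_simps inner_commute)
  also have "((\<beta> * norm u + \<rho>)\<^sup>2 \<le> (norm u)\<^sup>2 - 2 * (u \<bullet> w) + (norm w)\<^sup>2) \<longleftrightarrow>
     (\<beta>\<^sup>2 - 1) * (norm u)\<^sup>2 + 2 * \<beta> * \<rho> * norm u + 2 * (u \<bullet> w) \<le> (norm w)\<^sup>2 - \<rho>\<^sup>2"
    by (simp add: power2_eq_square algebra_simps)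
  finally show ?thesis
    by (simp add: u_def w_def dist_norm norm_minus_commute)
qed

lemma convex_safe: "convex (safe x)"
proof (rule convexI)
  fix P Q and u v :: real
  assume P: "P \<in> safe x" and Q: "Q \<in> safe x" and uv: "0 \<le> u" "0 \<le> v" "u + v = 1"
  define p where "p = P - fst x"
  define q where "q = Q - fst x"
  define w where "w = snd x - fst x"
  define C where "C = (dist (fst x) (snd x))\<^sup>2 - \<rho>\<^sup>2"
  have pq: "u *\<^sub>R P + v *\<^sub>R Q - fst x = u *\<^sub>R p + v *\<^sub>R q"
    using uv(3) by (simp add: p_def q_def algebra_simps flip: scaleR_add_left)
  have n: "norm (u *\<^sub>R p + v *\<^sub>R q) \<le> u * norm p + v * norm q"
    using uv by (intro norm_triangle_le) simp
  then have "(norm (u *\<^sub>R p + v *\<^sub>R q))\<^sup>2 \<le> (u * norm p + v * norm q)\<^sup>2"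
    by (intro power_mono) auto
  also have "\<dots> = u * (norm p)\<^sup>2 + v * (norm q)\<^sup>2 - u * v * (norm p - norm q)\<^sup>2"
  proof -
    have v: "v = 1 - u" using uv by simp
    show ?thesis unfolding v by (simp add: power2_eq_square algebra_simps)
  qed
  also have "\<dots> \<le> u * (norm p)\<^sup>2 + v * (norm q)\<^sup>2"
    using uv by simp
  finally have n2: "(norm (u *\<^sub>R p + v *\<^sub>R q))\<^sup>2 \<le> u * (norm p)\<^sup>2 + v * (norm q)\<^sup>2" .
  have "\<beta>\<^sup>2 \<ge> 1" using speed by (simp add: power2_eq_square) (metis less_1_mult less_imp_le)
  with n2 have "(\<beta>\<^sup>2 - 1) * (norm (u *\<^sub>R p + v *\<^sub>R q))\<^sup>2
      \<le> (\<beta>\<^sup>2 - 1) * (u * (norm p)\<^sup>2 + v * (norm q)\<^sup>2)"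
    by (intro mult_left_mono) auto
  moreover from n have "2 * \<beta> * \<rho> * norm (u *\<^sub>R p + v *\<^sub>R q) \<le> 2 * \<beta> * \<rho> * (u * norm p + v * norm q)"
    using speed range by (intro mult_left_mono) auto
  moreover have "2 * ((u *\<^sub>R p + v *\<^sub>R q) \<bullet> w) = u * (2 * (p \<bullet> w)) + v * (2 * (q \<bullet> w))"
    by (simp add: algebra_simps)
  moreover have "u * ((\<beta>\<^sup>2 - 1) * (norm p)\<^sup>2 + 2 * \<beta> * \<rho> * norm p + 2 * (p \<bullet> w))
      + v * ((\<beta>\<^sup>2 - 1) * (norm q)\<^sup>2 + 2 * \<beta> * \<rho> * norm q + 2 * (q \<bullet> w)) \<le> u * C + v * C"
    using P Q uv unfolding safe_iff p_def q_def w_def C_def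
    by (intro add_mono mult_left_mono) auto
  moreover have "u * C + v * C = C" using uv(3) by (metis distrib_right mult_1)
  ultimately show "u *\<^sub>R P + v *\<^sub>R Q \<in> safe x"
    unfolding safe_iff pq w_def[symmetric] C_def[symmetric] by (simp add: algebra_simps)
qed

lemma closed_safe: "closed (safe x)"
  unfolding safe_def by (intro closed_Collect_le continuous_intros)

lemma leader_in_safe: "x \<in> apart \<Longrightarrow> fst x \<in> safe x"
  by (simp add: safe_def apart_def dist_commute)

lemma aim_in_safe: "x \<in> apart \<Longrightarrow> aim x \<in> safe x"
  unfolding aim_def using leader_in_safe by (intro closest_point_in_set closed_safe) blast

lemma miss_le: "P \<in> safe x \<Longrightarrow> miss x \<le> dist a P"
  unfolding miss_def aim_def using closed_safe by (rule closest_point_le)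

lemma miss_nonneg: "0 \<le> miss x"
  by (simp add: miss_def)

lemma aim_unique: "P \<in> safe x \<Longrightarrow> dist a P \<le> miss x \<Longrightarrow> P = aim x"
  unfolding aim_def
  by (rule closest_point_unique[OF convex_safe closed_safe]) (auto dest: miss_le)

text \<open>The angle at the closest point of a convex set is not acute. This makes uniqueness of
  the aim point quantitative: a safe point almost as close to the asset lies near
  \<open>aim x\<close>.\<close>

lemma aim_pythagoras:
  assumes "P \<in> safe x"
  shows "(dist P (aim x))\<^sup>2 \<le> (dist a P)\<^sup>2 - (miss x)\<^sup>2"
proof -
  have "(a - aim x) \<bullet> (P - aim x) \<le> 0"
    unfolding aim_def by (rule closest_point_dot[OF convex_safe closed_safe assms])
  moreover have "(dist a P)\<^sup>2 = (miss x)\<^sup>2 - 2 * ((a - aim x) \<bullet> (P - aim x)) + (dist P (aim x))\<^sup>2"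
    by (simp add: miss_def dist_norm power2_norm_eq_inner algebra_simps inner_commute)
  ultimately show ?thesis by simp
qed

text \<open>A step of length \<delta> from P towards the leader lowers the left side of the safety
  inequality by \<beta> \<delta> and the right side by at most \<delta>, so it repairs a deficit of
  (\<beta> - 1) \<delta>. If the leader is nearer than \<delta>, its own position serves.\<close>

lemma near_safe:
  assumes "x \<in> apart" "0 \<le> e" and P: "\<beta> * dist (fst x) P + \<rho> \<le> dist (snd x) P + e"
  obtains Q where "Q \<in> safe x" "dist P Q \<le> e / (\<beta> - 1)"
proof -
  define B where "B = fst x"
  define R where "R = snd x"
  define \<delta> where "\<delta> = e / (\<beta> - 1)"
  have \<delta>: "0 \<le> \<delta>" "(\<beta> - 1) * \<delta> = e" using speed \<open>0 \<le> e\<close> by (simp_all add: \<delta>_def)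
  show thesis
  proof (cases "dist B P \<le> \<delta>")
    case True
    then show thesis
      using that[of B] leader_in_safe[OF assms(1)] by (simp add: B_def \<delta>_def dist_commute)
  next
    case False
    define Q where "Q = P + (\<delta> / dist B P) *\<^sub>R (B - P)"
    have PQ: "dist P Q = \<delta>"
      using False \<delta>(1) by (auto simp: Q_def dist_norm)
    have "Q - B = (1 - \<delta> / dist B P) *\<^sub>R (P - B)"
      by (simp add: Q_def algebra_simps)
    then have "dist B Q = \<bar>1 - \<delta> / dist B P\<bar> * dist B P"
      by (metis dist_commute dist_norm norm_scaleR)
    also have "\<dots> = dist B P - \<delta>"
    proof -
      have "0 < dist B P" "\<delta> / dist B P \<le> 1" using False \<delta>(1) by (auto simp: divide_le_eq_1)
      then show ?thesis by (simp add: left_diff_distrib)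
    qed
    finally have BQ: "dist B Q = dist B P - \<delta>" .
    have "dist R P \<le> dist R Q + \<delta>"
      using dist_triangle[of R P Q] PQ by (simp add: dist_commute)
    with P \<delta>(2) have "\<beta> * dist B Q + \<rho> \<le> dist R Q"
      unfolding BQ by (simp add: B_def R_def algebra_simps)
    then show thesis using that[of Q] PQ by (simp add: safe_def B_def R_def \<delta>_def)
  qed
qed

lemma miss_le_near:
  assumes "x \<in> apart" "0 \<le> e" "\<beta> * dist (fst x) P + \<rho> \<le> dist (snd x) P + e"
  shows "miss x \<le> dist a P + e / (\<beta> - 1)"
proof -
  obtain Q where "Q \<in> safe x" "dist P Q \<le> e / (\<beta> - 1)"
    using near_safe[OF assms] .
  then show ?thesis using miss_le[of Q x] dist_triangle[of a Q P] by linarith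
qed

text \<open>A step of length \<delta> in any direction costs at most (\<beta> + 1) \<delta> of
  surplus, so the whole disk of radius e / (\<beta> + 1) about P is safe; its point nearest to the
  asset gives the bound, with 0 if the disk contains the asset.\<close>

lemma miss_le_deep:
  assumes "0 \<le> e" and P: "\<beta> * dist (fst x) P + \<rho> + e \<le> dist (snd x) P"
  shows "miss x \<le> max 0 (dist a P - e / (\<beta> + 1))"
proof -
  define \<delta> where "\<delta> = e / (\<beta> + 1)"
  have \<delta>: "0 \<le> \<delta>" "(\<beta> + 1) * \<delta> = e" using speed \<open>0 \<le> e\<close> by (simp_all add: \<delta>_def)
  have shift: "Q \<in> safe x" if "dist P Q \<le> \<delta>" for Q
  proof -
    have "\<beta> * dist (fst x) Q \<le> \<beta> * (dist (fst x) P + \<delta>)"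
      using that speed dist_triangle[of "fst x" Q P] by (intro mult_left_mono) auto
    moreover have "dist (snd x) P \<le> dist (snd x) Q + \<delta>"
      using that dist_triangle[of "snd x" P Q] by (simp add: dist_commute)
    ultimately show ?thesis using P \<delta>(2) by (simp add: safe_def algebra_simps)
  qed
  show ?thesis
  proof (cases "dist a P \<le> \<delta>")
    case True
    then have "miss x \<le> dist a a" by (intro miss_le shift) (simp add: dist_commute)
    then show ?thesis by simp
  next
    case False
    define Q where "Q = P + (\<delta> / dist a P) *\<^sub>R (a - P)"
    have "dist P Q = \<delta>"
      using False \<delta>(1) by (auto simp: Q_def dist_norm)
    have "Q - a = (1 - \<delta> / dist a P) *\<^sub>R (P - a)"
      by (simp add: Q_def algebra_simps)
    then have "dist a Q = \<bar>1 - \<delta> / dist a P\<bar> * dist a P"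
      by (metis dist_commute dist_norm norm_scaleR)
    moreover have "0 < dist a P" "\<delta> / dist a P \<le> 1" using False \<delta>(1) by (auto simp: divide_le_eq_1)
    ultimately have "dist a Q = dist a P - \<delta>"
      by (simp add: left_diff_distrib)
    with \<open>dist P Q = \<delta>\<close> show ?thesis using miss_le[OF shift, of Q] by (simp add: \<delta>_def)
  qed
qed

section \<open>Dependence of \<open>miss\<close> and \<open>aim\<close> on the state\<close>

lemma safe_at_other_state:
  assumes "P \<in> safe x"
  shows "\<beta> * dist (fst y) P + \<rho> \<le> dist (snd y) P + (\<beta> * dist (fst x) (fst y) + dist (snd x) (snd y))"
proof -
  have "\<beta> * dist (fst y) P \<le> \<beta> * (dist (fst x) (fst y) + dist (fst x) P)"
    using speed dist_triangle[of "fst y" P "fst x"] by (intro mult_left_mono) (auto simp: dist_commute)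
  moreover have "dist (snd x) P \<le> dist (snd x) (snd y) + dist (snd y) P"
    by (rule dist_triangle)
  ultimately show ?thesis using assms by (simp add: safe_def algebra_simps)
qed

lemma miss_lipschitz:
  assumes "x \<in> apart" "y \<in> apart"
  shows "miss y \<le> miss x + (\<beta> * dist (fst x) (fst y) + dist (snd x) (snd y)) / (\<beta> - 1)"
  using miss_le_near[OF assms(2) _ safe_at_other_state[OF aim_in_safe[OF assms(1)]]] speed
  by (simp add: miss_def)

text \<open>The aim point of y is within e of a point Q safe at x, and Q is at most 2 e farther from
  the asset than \<open>aim x\<close>. By \<open>aim_pythagoras\<close> the excess of the squared
  distances, \<open>4 * e * miss x + 4 * e\<^sup>2\<close>, bounds the squared distance from Q to
  \<open>aim x\<close>.\<close>

lemma aim_modulus: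
  assumes "x \<in> apart" "y \<in> apart"
  defines "e \<equiv> (\<beta> * dist (fst x) (fst y) + dist (snd x) (snd y)) / (\<beta> - 1)"
  shows "dist (aim y) (aim x) \<le> e + sqrt (4 * e * miss x + 4 * e\<^sup>2)"
proof -
  have "0 \<le> e" using speed by (simp add: e_def)
  obtain Q where Q: "Q \<in> safe x" "dist (aim y) Q \<le> e"
    using near_safe[OF assms(1) _ safe_at_other_state[OF aim_in_safe[OF assms(2)]]] speed
    by (metis (no_types, opaque_lifting) add_nonneg_nonneg dist_commute e_def less_imp_le
        mult_nonneg_nonneg zero_le_dist zero_less_one order.strict_trans)
  have "dist a Q \<le> miss x + 2 * e"
    using miss_lipschitz[OF assms(1,2), folded e_def] Q(2) dist_triangle[of a Q "aim y"]
    by (simp add: miss_def)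
  then have "(dist a Q)\<^sup>2 \<le> (miss x + 2 * e)\<^sup>2"
    by (intro power_mono) auto
  with aim_pythagoras[OF Q(1)] have "(dist Q (aim x))\<^sup>2 \<le> 4 * e * miss x + 4 * e\<^sup>2"
    by (simp add: power2_eq_square algebra_simps)
  then have "dist Q (aim x) \<le> sqrt (4 * e * miss x + 4 * e\<^sup>2)"
    by (rule real_le_rsqrt)
  with Q(2) show ?thesis using dist_triangle[of "aim y" "aim x" Q] by linarith
qed

lemma continuous_on_aim: "continuous_on apart aim"
  unfolding continuous_on_def
proof
  fix x assume x: "x \<in> apart"
  define e where "e y = (\<beta> * dist (fst x) (fst y) + dist (snd x) (snd y)) / (\<beta> - 1)" for y
  have e: "(e \<longlongrightarrow> 0) (at x within apart)"
    unfolding e_def by (rule tendsto_eq_intros refl | use speed in simp)+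
  have "((\<lambda>y. e y + sqrt (4 * e y * miss x + 4 * (e y)\<^sup>2)) \<longlongrightarrow> 0) (at x within apart)"
    by (rule tendsto_eq_intros e refl | simp)+
  then have "((\<lambda>y. dist (aim y) (aim x)) \<longlongrightarrow> 0) (at x within apart)"
  proof (rule tendsto_sandwich[rotated 3, OF _])
    show "eventually (\<lambda>y. dist (aim y) (aim x) \<le> e y + sqrt (4 * e y * miss x + 4 * (e y)\<^sup>2)) (at x within apart)"
      unfolding eventually_at_filter e_def using aim_modulus[OF x] by (simp add: always_eventually)
  qed auto
  then show "(aim \<longlongrightarrow> aim x) (at x within apart)"
    by (simp add: tendsto_dist_iff[of aim])
qed

text \<open>Before blocking, the leader's own position has positive surplus, so some safe point is
  strictly closer to the asset.\<close>

lemma aim_ne_leader: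
  assumes "x \<in> play_states"
  shows "aim x \<noteq> fst x"
proof
  assume eq: "aim x = fst x"
  let ?e = "dist (fst x) (snd x) - \<rho>"
  have "?e > 0" "dist a (fst x) > 0"
    using assms zone by (auto simp: play_states_iff dist_commute)
  then have "0 < ?e / (\<beta> + 1)" using speed by simp
  moreover have "miss x \<le> max 0 (dist a (fst x) - ?e / (\<beta> + 1))"
    using miss_le_deep[of ?e x "fst x"] \<open>?e > 0\<close> by (simp add: dist_commute)
  ultimately have "miss x < dist a (fst x)"
    using \<open>dist a (fst x) > 0\<close> by linarith
  then show False using eq by (simp add: miss_def)
qed

lemma interceptor_far:
  assumes "P \<in> safe x"
  shows "\<rho> \<le> dist (snd x) P"
proof -
  have "0 \<le> \<beta> * dist (fst x) P" using speed by simp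
  with assms show ?thesis by (simp add: safe_def)
qed

lemma aim_ne_interceptor: "x \<in> apart \<Longrightarrow> aim x \<noteq> snd x"
  using interceptor_far[OF aim_in_safe] range by fastforce

lemma dist_safe_le:
  assumes "P \<in> safe x"
  shows "(\<beta> - 1) * dist (fst x) P \<le> dist (fst x) (snd x) - \<rho>"
  using assms dist_triangle[of "snd x" P "fst x"] by (simp add: safe_def dist_commute algebra_simps)

text \<open>At separation \<rho> the bound \<open>dist_safe_le\<close> shrinks the safe region to
  the leader's position.\<close>

lemma miss_at_blocking:
  assumes "dist (fst x) (snd x) = \<rho>"
  shows "miss x = dist a (fst x)"
proof -
  have "(\<beta> - 1) * dist (fst x) (aim x) \<le> 0"
    using dist_safe_le[OF aim_in_safe, of x] assms by (simp add: apart_def)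
  then show ?thesis
    using speed by (simp add: mult_le_0_iff miss_def)
qed

lemma miss_le_dist: "x \<in> apart \<Longrightarrow> miss x \<le> dist a (fst x)"
  by (intro miss_le leader_in_safe)

text \<open>A surplus at the aim point would allow a step towards the asset, by
  \<open>miss_le_deep\<close>.\<close>

lemma aim_on_boundary:
  assumes "x \<in> apart" "0 < miss x"
  shows "dist (snd x) (aim x) = \<beta> * dist (fst x) (aim x) + \<rho>"
proof (rule ccontr)
  let ?e = "dist (snd x) (aim x) - (\<beta> * dist (fst x) (aim x) + \<rho>)"
  assume "\<not> ?thesis"
  then have "0 < ?e" using aim_in_safe[OF assms(1)] by (simp add: safe_def)
  then have "0 < ?e / (\<beta> + 1)" using speed by simp
  moreover have "miss x \<le> max 0 (miss x - ?e / (\<beta> + 1))"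
    using miss_le_deep[of ?e x "aim x"] \<open>0 < ?e\<close> by (simp add: miss_def)
  ultimately show False using assms(2) by (auto simp: max_def split: if_splits)
qed

text \<open>
  The safe region contains the disk of radius \<open>(X - \<rho>) / (\<beta> + 1)\<close> about the leader, where \<open>X\<close> is the
  separation, and is contained in the one of radius \<open>(X - \<rho>) / (\<beta> - 1)\<close>.
\<close>

lemma aim_progress:
  assumes x: "x \<in> apart"
  shows "(\<beta> - 1) / (\<beta> + 1) * (dist (fst x) (aim x) * dist (fst x) a)
    \<le> (a - fst x) \<bullet> (aim x - fst x)"
proof -
  define B where "B = fst x"
  define p where "p = aim x"
  define k where "k = (\<beta> - 1) / (\<beta> + 1)"
  define m where "m = (dist B (snd x) - \<rho>) / (\<beta> + 1)"
  have k: "0 \<le> k" "k \<le> 1" using speed by (auto simp: k_def)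
  have m: "0 \<le> m" "(\<beta> + 1) * m = dist B (snd x) - \<rho>"
    using speed x by (auto simp: m_def apart_def B_def)
  have km: "k * dist B p \<le> m"
    using dist_safe_le[OF aim_in_safe[OF x]] speed
    by (simp add: k_def m_def B_def p_def divide_simps)
  \<comment> \<open>The point of the inner disk that lies farthest in the direction from the aim
    point to the asset; k is the ratio of the two radii.\<close>
  define Q where "Q = B + m *\<^sub>R sgn (a - p)"
  have BQ: "dist B Q \<le> m"
    using m(1) by (simp add: Q_def dist_norm norm_sgn)
  have "\<beta> * dist B Q \<le> \<beta> * m" using BQ speed by (intro mult_left_mono) auto
  moreover have "dist B (snd x) \<le> dist B Q + dist (snd x) Q"
    by (metis dist_commute dist_triangle)
  ultimately have "Q \<in> safe x"
    using BQ m(2) by (simp add: safe_def B_def algebra_simps)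
  then have "(a - p) \<bullet> (Q - p) \<le> 0"
    unfolding p_def aim_def by (intro closest_point_dot convex_safe closed_safe)
  moreover have "(a - p) \<bullet> (Q - p) = m * norm (a - p) - (a - p) \<bullet> (p - B)"
    by (simp add: Q_def sgn_div_norm inner_diff_right inner_add_right dot_square_norm power2_eq_square divide_simps)
  ultimately have "m * norm (a - p) \<le> (a - p) \<bullet> (p - B)" by simp
  moreover have "k * dist B p * norm (a - p) \<le> m * norm (a - p)"
    using km by (intro mult_right_mono) auto
  moreover have "k * (dist B p)\<^sup>2 \<le> (dist B p)\<^sup>2"
    using k mult_right_mono[of k 1 "(dist B p)\<^sup>2"] by simp
  moreover have "(a - B) \<bullet> (p - B) = (dist B p)\<^sup>2 + (a - p) \<bullet> (p - B)"
    by (simp add: dist_norm power2_norm_eq_inner algebra_simps inner_commute)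
  moreover have "k * (dist B p * dist B a) \<le> k * (dist B p * (dist B p + norm (a - p)))"
    using k(1) dist_triangle[of B a p] by (intro mult_left_mono) (auto simp: dist_norm norm_minus_commute)
  ultimately show ?thesis
    unfolding B_def[symmetric] p_def[symmetric] k_def[symmetric]
    by (simp add: power2_eq_square algebra_simps)
qed

section \<open>The homing laws\<close>

definition homing_leader :: feedback where
  "homing_leader x = heading (aim x - fst x)"

definition homing_interceptor :: feedback where
  "homing_interceptor x = heading (aim x - snd x)"

lemma cis_homing_leader: "x \<in> play_states \<Longrightarrow> cis (homing_leader x) = sgn (aim x - fst x)"
  unfolding homing_leader_def using aim_ne_leader by (intro cis_heading) auto

lemma cis_homing_interceptor: "x \<in> apart \<Longrightarrow> cis (homing_interceptor x) = sgn (aim x - snd x)"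
  unfolding homing_interceptor_def using aim_ne_interceptor by (intro cis_heading) auto

lemma continuous_on_aim_play_states: "continuous_on play_states aim"
  using continuous_on_aim by (rule continuous_on_subset) (use play_states_apart in blast)

lemma regular_homing_leader: "regular_law \<rho> \<rho>s a homing_leader"
proof -
  have "continuous_on play_states (\<lambda>x. sgn (aim x - fst x))"
    by (intro continuous_intros continuous_on_aim_play_states) (use aim_ne_leader in auto)
  then show ?thesis
    unfolding regular_law_def feedback_law_def
    using heading_range cis_homing_leader by (simp add: homing_leader_def cong: continuous_on_cong)
qed

lemma regular_homing_interceptor: "regular_law \<rho> \<rho>s a homing_interceptor"
proof -
  have "continuous_on play_states (\<lambda>x. sgn (aim x - snd x))"
    by (intro continuous_intros continuous_on_aim_play_states)
      (use aim_ne_interceptor play_states_apart in auto)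
  then show ?thesis
    unfolding regular_law_def feedback_law_def
    using heading_range cis_homing_interceptor play_states_apart
    by (simp add: homing_interceptor_def cong: continuous_on_cong)
qed

end

section \<open>Plays\<close>

lemma has_integral_increment:
  fixes f :: "real \<Rightarrow> complex"
  assumes "(f has_integral (F s - c)) {0..s}" "(f has_integral (F t - c)) {0..t}" "0 \<le> s" "s \<le> t"
  shows "(f has_integral (F t - F s)) {s..t}"
proof -
  have "f integrable_on {s..t}"
    using assms(2-4) by (auto intro: integrable_subinterval_real)
  then have i: "(f has_integral integral {s..t} f) {s..t}"
    by (rule integrable_integral)
  from has_integral_combine[OF assms(3,4,1) i] assms(2)
  have "F s - c + integral {s..t} f = F t - c" by (rule has_integral_unique)
  then have "integral {s..t} f = F t - F s" by (simp add: algebra_simps)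
  with i show ?thesis by simp
qed

text \<open>One-sided fundamental theorem of calculus in the form of an increment estimate; the
  integrand may be discontinuous away from t.\<close>

lemma has_integral_right_slope:
  fixes f :: "real \<Rightarrow> complex"
  assumes int: "\<And>h. 0 < h \<Longrightarrow> h < d \<Longrightarrow> (f has_integral (F (t + h) - F t)) {t..t + h}"
    and "0 < d" and cont: "continuous (at_right t) f" and "0 < e"
  shows "eventually (\<lambda>h. dist (F (t + h)) (F t + h *\<^sub>R f t) \<le> e * h) (at_right 0)"
proof -
  have "eventually (\<lambda>s. dist (f s) (f t) < e) (at_right t)"
    using cont \<open>0 < e\<close> unfolding continuous_within by (rule tendstoD)
  then obtain b where "b > t" and b: "\<And>s. t < s \<Longrightarrow> s < b \<Longrightarrow> dist (f s) (f t) < e"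
    unfolding eventually_at_right_field by blast
  show ?thesis
    unfolding eventually_at_right_field
  proof (intro exI[of _ "min d (b - t)"] conjI allI impI)
    fix h assume h: "0 < h" "h < min d (b - t)"
    have i: "((\<lambda>s. f s - f t) has_integral (F (t + h) - F t - h *\<^sub>R f t)) {t..t + h}"
      using has_integral_diff[OF int has_integral_const_real[of "f t" t "t + h"]] h by simp
    have "norm (f s - f t) \<le> e" if "s \<in> {t..t + h}" for s
      using that b[of s] h \<open>0 < e\<close> by (cases "s = t") (auto simp: dist_norm)
    then have "norm (F (t + h) - F t - h *\<^sub>R f t) \<le> e * measure lborel {t..t + h}"
      using \<open>0 < e\<close> by (intro has_integral_bound_real[OF _ _ i, where S = "{}"]) auto
    then show "dist (F (t + h)) (F t + h *\<^sub>R f t) \<le> e * h"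
      using h by (simp add: dist_norm algebra_simps)
  qed (use \<open>0 < d\<close> \<open>b > t\<close> in simp)
qed

lemma inner_unit_less_1:
  fixes u v :: "'a::real_inner"
  assumes "norm u = 1" "norm v = 1" "u \<noteq> v"
  shows "u \<bullet> v < 1"
proof -
  have "0 < (norm (u - v))\<^sup>2" using assms by simp
  also have "\<dots> = 2 - 2 * (u \<bullet> v)"
    using assms by (simp add: norm_eq_1 power2_norm_eq_inner inner_commute algebra_simps)
  finally show ?thesis by simp
qed

context blocking_game
begin

text \<open>Common form of a terminating play and of an initial piece of an endless one. The start
  is required to be a playing state separately, since for T = 0 the last condition is empty.\<close>

definition partial_play :: "feedback \<Rightarrow> feedback \<Rightarrow> state \<Rightarrow> (real \<Rightarrow> state) \<Rightarrow> real \<Rightarrow> bool" where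
  "partial_play \<gamma>B \<gamma>R x z T \<longleftrightarrow>
     0 \<le> T \<and> follows \<beta> \<gamma>B \<gamma>R x z {0..T} \<and> x \<in> play_states \<and> (\<forall>t\<in>{0..<T}. z t \<in> play_states)"

context
  fixes \<gamma>B \<gamma>R x z T
  assumes play: "partial_play \<gamma>B \<gamma>R x z T"
begin

lemma play_in: "0 \<le> t \<Longrightarrow> t < T \<Longrightarrow> z t \<in> play_states"
  using play by (simp add: partial_play_def)

lemma play_start: "z 0 = x"
proof -
  have "follows \<beta> \<gamma>B \<gamma>R x z {0..T}" "0 \<in> {0..T}" using play by (auto simp: partial_play_def)
  then have "((\<lambda>s. cis (\<gamma>B (z s))) has_integral (fst (z 0) - fst x)) {0..0}"
    "((\<lambda>s. of_real \<beta> * cis (\<gamma>R (z s))) has_integral (snd (z 0) - snd x)) {0..0}"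
    unfolding follows_def by blast+
  then have "fst (z 0) - fst x = 0" "snd (z 0) - snd x = 0"
    using has_integral_unique[OF _ has_integral_refl(2)] by (metis atLeastAtMost_singleton)+
  then show ?thesis by (simp add: prod_eq_iff)
qed

lemma play_integral:
  assumes "0 \<le> s" "s \<le> t" "t \<le> T"
  shows "((\<lambda>r. cis (\<gamma>B (z r))) has_integral (fst (z t) - fst (z s))) {s..t}"
    and "((\<lambda>r. of_real \<beta> * cis (\<gamma>R (z r))) has_integral (snd (z t) - snd (z s))) {s..t}"
  using play assms unfolding partial_play_def follows_def
  by (auto intro!: has_integral_increment[of _ "\<lambda>t. fst (z t)" _ "fst x"]
      has_integral_increment[of _ "\<lambda>t. snd (z t)" _ "snd x"])

lemma play_speed:
  assumes "0 \<le> s" "s \<le> t" "t \<le> T"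
  shows "dist (fst (z s)) (fst (z t)) \<le> t - s" "dist (snd (z s)) (snd (z t)) \<le> \<beta> * (t - s)"
proof -
  note i = play_integral[OF assms]
  have "norm (fst (z t) - fst (z s)) \<le> 1 * measure lborel (cbox s t)"
    by (rule has_integral_bound) (use i(1) in auto)
  then show "dist (fst (z s)) (fst (z t)) \<le> t - s"
    using assms by (simp add: dist_norm norm_minus_commute)
  have "norm (snd (z t) - snd (z s)) \<le> \<beta> * measure lborel (cbox s t)"
    by (rule has_integral_bound) (use i(2) speed in \<open>auto simp: norm_mult\<close>)
  then show "dist (snd (z s)) (snd (z t)) \<le> \<beta> * (t - s)"
    using assms by (simp add: dist_norm norm_minus_commute)
qed

lemma play_continuous: "continuous_on {0..T} z"
proof -
  have 1: "1-lipschitz_on {0..T} (\<lambda>t. fst (z t))"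
  proof (rule lipschitz_on_leI)
    fix s t assume "s \<in> {0..T}" "t \<in> {0..T}" "s \<le> t"
    then show "dist (fst (z s)) (fst (z t)) \<le> 1 * dist s t"
      using play_speed(1)[of s t] by (simp add: dist_real_def)
  qed simp
  have 2: "\<beta>-lipschitz_on {0..T} (\<lambda>t. snd (z t))"
  proof (rule lipschitz_on_leI)
    fix s t assume "s \<in> {0..T}" "t \<in> {0..T}" "s \<le> t"
    then show "dist (snd (z s)) (snd (z t)) \<le> \<beta> * dist s t"
      using play_speed(2)[of s t] by (simp add: dist_real_def)
  qed (use speed in simp)
  have "continuous_on {0..T} (\<lambda>t. (fst (z t), snd (z t)))"
    by (intro continuous_on_Pair lipschitz_on_continuous_on[OF 1] lipschitz_on_continuous_on[OF 2])
  then show ?thesis by simp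
qed

lemma play_closure:
  assumes "0 \<le> t" "t \<le> T"
  shows "z t \<in> apart" "\<rho>s \<le> dist (fst (z t)) a"
proof -
  have "z t \<in> {y. \<rho> \<le> dist (fst y) (snd y) \<and> \<rho>s \<le> dist (fst y) a}"
  \<comment> \<open>For T = 0 the interval \<open>{0..<T}\<close> is empty and its closure gives
    nothing, but \<open>z t\<close> is then the initial state.\<close>
  proof (cases "T = 0")
    case True
    then show ?thesis
      using play assms play_start by (auto simp: partial_play_def play_states_iff)
  next
    case False
    then have "closure {0..<T} = {0..T}" using assms by simp
    moreover have "z ` closure {0..<T} \<subseteq> {y. \<rho> \<le> dist (fst y) (snd y) \<and> \<rho>s \<le> dist (fst y) a}"
    proof (rule image_closure_subset)
      show "continuous_on (closure {0..<T}) z"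
        using play_continuous calculation by simp
      show "closed {y::state. \<rho> \<le> dist (fst y) (snd y) \<and> \<rho>s \<le> dist (fst y) a}"
        by (intro closed_Collect_conj closed_Collect_le continuous_intros)
      show "z ` {0..<T} \<subseteq> {y. \<rho> \<le> dist (fst y) (snd y) \<and> \<rho>s \<le> dist (fst y) a}"
        using play_in by (force simp: play_states_iff)
    qed
    ultimately have "z ` {0..T} \<subseteq> {y. \<rho> \<le> dist (fst y) (snd y) \<and> \<rho>s \<le> dist (fst y) a}" by simp
    moreover have "z t \<in> z ` {0..T}" using assms by simp
    ultimately show ?thesis by (rule subsetD)
  qed
  then show "z t \<in> apart" "\<rho>s \<le> dist (fst (z t)) a" by (simp_all add: apart_def)
qed

lemma play_continuous_aim: "continuous_on {0..T} (\<lambda>t. aim (z t))"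
  using play_closure(1) by (intro continuous_on_compose2[OF continuous_on_aim play_continuous]) auto

lemma play_continuous_miss: "continuous_on {0..T} (\<lambda>t. miss (z t))"
  unfolding miss_def by (intro continuous_intros play_continuous_aim)

lemma play_slope:
  assumes "0 \<le> t" "t < T" "0 < e"
  shows "regular_law \<rho> \<rho>s a \<gamma>B \<Longrightarrow>
      eventually (\<lambda>h. dist (fst (z (t + h))) (fst (z t) + h *\<^sub>R cis (\<gamma>B (z t))) \<le> e * h) (at_right 0)"
    and "regular_law \<rho> \<rho>s a \<gamma>R \<Longrightarrow>
      eventually (\<lambda>h. dist (snd (z (t + h))) (snd (z t) + h *\<^sub>R (of_real \<beta> * cis (\<gamma>R (z t)))) \<le> e * h) (at_right 0)"
proof -
  have c: "continuous (at_right t) (\<lambda>s. cis (\<gamma> (z s)))" if "regular_law \<rho> \<rho>s a \<gamma>" for \<gamma>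
  proof -
    have "continuous_on {0..<T} z"
      using play_continuous by (rule continuous_on_subset) auto
    moreover have "continuous_on play_states (\<lambda>x. cis (\<gamma> x))"
      using that by (simp add: regular_law_def)
    then have "continuous_on (z ` {0..<T}) (\<lambda>x. cis (\<gamma> x))"
      by (rule continuous_on_subset) (use play_in in auto)
    ultimately have "continuous_on {0..<T} (\<lambda>s. cis (\<gamma> (z s)))"
      using continuous_on_compose[of "{0..<T}" z "\<lambda>x. cis (\<gamma> x)"] by (simp only: o_def)
    \<comment> \<open>The state \<open>z T\<close> may be terminal, and the law may jump there, so
      the interval stops short of T.\<close>
    then have "continuous_on {t..(t + T) / 2} (\<lambda>s. cis (\<gamma> (z s)))"
      by (rule continuous_on_subset) (use assms in auto)
    then have "continuous (at t within {t..(t + T) / 2}) (\<lambda>s. cis (\<gamma> (z s)))"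
      using assms by (simp add: continuous_on_eq_continuous_within)
    then show ?thesis
      using assms by (simp add: at_within_Icc_at_right)
  qed
  show "eventually (\<lambda>h. dist (fst (z (t + h))) (fst (z t) + h *\<^sub>R cis (\<gamma>B (z t))) \<le> e * h) (at_right 0)"
    if "regular_law \<rho> \<rho>s a \<gamma>B"
    using assms c[OF that] play_integral(1)
    by (intro has_integral_right_slope[where d = "T - t"]) auto
  show "eventually (\<lambda>h. dist (snd (z (t + h))) (snd (z t) + h *\<^sub>R (of_real \<beta> * cis (\<gamma>R (z t)))) \<le> e * h) (at_right 0)"
    if "regular_law \<rho> \<rho>s a \<gamma>R"
    using assms c[OF that] play_integral(2)
    by (intro has_integral_right_slope[where d = "T - t"]) (auto intro!: continuous_intros)
qed

end

lemma partial_play_of_terminating: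
  "x \<in> play_states \<Longrightarrow> terminating_play \<beta> \<rho> \<rho>s a \<gamma>B \<gamma>R x z tf \<Longrightarrow> partial_play \<gamma>B \<gamma>R x z tf"
  by (simp add: terminating_play_def partial_play_def)

lemma partial_play_of_endless:
  "endless_play \<beta> \<rho> \<rho>s a \<gamma>B \<gamma>R x z \<Longrightarrow> x \<in> play_states \<Longrightarrow> 0 \<le> T \<Longrightarrow> partial_play \<gamma>B \<gamma>R x z T"
  by (simp add: endless_play_def partial_play_def follows_def)

text \<open>A Peano solution either stays among the playing states, giving an endless play, or has a
  first time outside this open set. At that time the non-strict inequalities of
  \<open>play_closure\<close> still hold, so one of them is an equality and the play has
  terminated.\<close>

lemma payoffs_nonempty:
  assumes B: "regular_law \<rho> \<rho>s a \<gamma>B" and R: "regular_law \<rho> \<rho>s a \<gamma>R" and x: "x \<in> play_states"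
  shows "payoffs \<beta> \<rho> \<rho>s a \<gamma>B \<gamma>R x \<noteq> {}"
proof -
  define f where "f y = (cis (\<gamma>B y), of_real \<beta> * cis (\<gamma>R y))" for y
  have "continuous_on play_states f"
    unfolding f_def using B R by (auto simp: regular_law_def intro!: continuous_intros)
  moreover have "norm (f y) \<le> 1 + \<beta>" for y
    unfolding f_def using norm_Pair_le[of "cis (\<gamma>B y)" "of_real \<beta> * cis (\<gamma>R y)"] speed
    by (simp add: norm_mult)
  ultimately obtain z where z0: "z 0 = x"
    and lip: "\<And>s t. 0 \<le> s \<Longrightarrow> s \<le> t \<Longrightarrow> dist (z s) (z t) \<le> (1 + \<beta>) * (t - s)"
    and der: "\<And>t. 0 < t \<Longrightarrow> z t \<in> play_states \<Longrightarrow> (z has_vector_derivative f (z t)) (at t)"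
    using cauchy_peano[OF open_play_states, of f "1 + \<beta>" x] by blast
  have "(1 + \<beta>)-lipschitz_on {0..} z"
  proof (rule lipschitz_on_leI)
    fix s t :: real assume "s \<in> {0..}" "t \<in> {0..}" "s \<le> t"
    then show "dist (z s) (z t) \<le> (1 + \<beta>) * dist s t"
      using lip[of s t] by (simp add: dist_real_def)
  qed (use speed in simp)
  then have cont: "continuous_on {0..} z" by (rule lipschitz_on_continuous_on)
  have follows: "follows \<beta> \<gamma>B \<gamma>R x z {0..T}" if "\<And>t. 0 \<le> t \<Longrightarrow> t < T \<Longrightarrow> z t \<in> play_states" for T
    unfolding follows_def
  proof
    fix t assume t: "t \<in> {0..T}"
    have ct: "continuous_on {0..t} z" using cont by (rule continuous_on_subset) auto
    \<comment> \<open>The derivative is needed at interior times only, so \<open>z t\<close> itself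
      need not be a playing state.\<close>
    have "((\<lambda>s. f (z s)) has_integral (z t - z 0)) {0..t}"
      using t that by (intro fundamental_theorem_of_calculus_interior ct der) auto
    from has_integral_linear[OF this bounded_linear_fst] has_integral_linear[OF this bounded_linear_snd]
    show "((\<lambda>s. cis (\<gamma>B (z s))) has_integral (fst (z t) - fst x)) {0..t} \<and>
      ((\<lambda>s. of_real \<beta> * cis (\<gamma>R (z s))) has_integral (snd (z t) - snd x)) {0..t}"
      by (simp add: f_def o_def z0)
  qed
  show ?thesis
  proof (cases "\<forall>t\<ge>0. z t \<in> play_states")
    case True
    then have "follows \<beta> \<gamma>B \<gamma>R x z {0..T}" for T by (intro follows) auto
    then have "follows \<beta> \<gamma>B \<gamma>R x z {0..}"
      unfolding follows_def by (meson atLeastAtMost_iff atLeast_iff order_refl)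
    with True have "\<infinity> \<in> payoffs \<beta> \<rho> \<rho>s a \<gamma>B \<gamma>R x"
      unfolding payoffs_def endless_play_def by blast
    then show ?thesis by blast
  next
    case False
    define E where "E = {0..} \<inter> z -` (- play_states)"
    have "closed E"
      unfolding E_def using cont open_play_states
      by (intro continuous_closed_preimage) (auto simp: closed_Compl)
    moreover have "E \<noteq> {}" "bdd_below E" using False by (auto simp: E_def)
    ultimately have "Inf E \<in> E" by (rule closed_contains_Inf[rotated 2])
    define T where "T = Inf E"
    have T: "0 \<le> T" "z T \<notin> play_states" using \<open>Inf E \<in> E\<close> by (auto simp: E_def T_def)
    have before: "z t \<in> play_states" if "0 \<le> t" "t < T" for t
      using that cInf_lower[of t E] \<open>bdd_below E\<close> by (force simp: E_def T_def)
    have "partial_play \<gamma>B \<gamma>R x z T"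
      using T before follows x by (simp add: partial_play_def)
    from play_closure[OF this T(1)] T(2) have "z T \<in> terminal \<rho> \<rho>s a"
      by (cases "z T") (auto simp: play_states_iff apart_def terminal_def)
    then have "terminating_play \<beta> \<rho> \<rho>s a \<gamma>B \<gamma>R x z T"
      using T before follows by (simp add: terminating_play_def)
    then show ?thesis unfolding payoffs_def by blast
  qed
qed

end

section \<open>The effect of the homing laws\<close>

lemma dist_advance:
  fixes P X :: complex
  assumes "0 \<le> h" "h \<le> dist X P" "P \<noteq> X"
  shows "dist (X + h *\<^sub>R sgn (P - X)) P = dist X P - h"
proof -
  have n: "norm (P - X) > 0" using assms by simp
  have "P - (X + h *\<^sub>R sgn (P - X)) = (1 - h / norm (P - X)) *\<^sub>R (P - X)"
    by (simp add: sgn_div_norm algebra_simps divide_inverse)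
  then have "dist (X + h *\<^sub>R sgn (P - X)) P = \<bar>1 - h / norm (P - X)\<bar> * norm (P - X)"
    by (metis dist_commute dist_norm norm_scaleR)
  moreover have "h / norm (P - X) \<le> 1"
    using assms n by (simp add: divide_le_eq_1 dist_norm norm_minus_commute)
  ultimately show ?thesis
    using n by (simp add: left_diff_distrib dist_norm norm_minus_commute)
qed

text \<open>Projection onto w bounds the distance from below. With w the direction from X to P,
  velocity v closes the distance only at the rate \<open>v \<bullet> w\<close>, which is below its
  speed unless it points at P.\<close>

lemma dist_retreat:
  fixes P X Y v w :: complex
  assumes "dist Y (X + h *\<^sub>R v) \<le> d" "norm w = 1"
  shows "(P - X) \<bullet> w - h * (v \<bullet> w) - d \<le> dist Y P"
proof -
  have "(Y - (X + h *\<^sub>R v)) \<bullet> w \<le> norm (Y - (X + h *\<^sub>R v)) * norm w"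
    using Cauchy_Schwarz_ineq2 abs_le_D1 by blast
  also have "\<dots> \<le> d" using assms by (simp add: dist_norm)
  finally have "(P - X) \<bullet> w - h * (v \<bullet> w) - d \<le> (P - Y) \<bullet> w"
    by (simp add: algebra_simps)
  also have "\<dots> \<le> norm (P - Y) * norm w"
    using Cauchy_Schwarz_ineq2 abs_le_D1 by blast
  finally show ?thesis using assms(2) by (simp add: dist_norm norm_minus_commute)
qed

lemma inner_sgn_self: "x \<bullet> sgn x = norm (x :: complex)"
  by (cases "x = 0") (simp_all add: sgn_div_norm dot_square_norm power2_eq_square)

lemma eventually_small: "0 < c \<Longrightarrow> eventually (\<lambda>h::real. 0 < h \<and> h < c) (at_right 0)"
  by (auto simp: eventually_at_right_field intro: exI[of _ c])

context blocking_game
begin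

section \<open>Plays with a homing leader\<close>

context
  fixes \<gamma> x z T
  assumes play: "partial_play homing_leader \<gamma> x z T"
begin

lemma leader_slope:
  assumes "0 \<le> t" "t < T" "0 < e"
  shows "eventually (\<lambda>h. dist (fst (z (t + h))) (fst (z t) + h *\<^sub>R sgn (aim (z t) - fst (z t))) \<le> e * h) (at_right 0)"
  using play_slope(1)[OF play assms regular_homing_leader]
  unfolding cis_homing_leader[OF play_in[OF play assms(1,2)]] .

text \<open>Homing lowers the left side of the safety inequality at rate \<beta>. The interceptor is
  kept at its position at time t so that its motion can be estimated separately: by speed for
  monotonicity, by direction for strict decrease.\<close>

lemma leader_closing:
  assumes "0 \<le> t" "t < T" "0 < e"
  shows "eventually (\<lambda>h. \<beta> * dist (fst (z (t + h))) (aim (z t)) + \<rho>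
    \<le> dist (snd (z t)) (aim (z t)) - \<beta> * h + e * h) (at_right 0)"
proof -
  let ?B = "fst (z t)" and ?p = "aim (z t)"
  have "?p \<noteq> ?B" using play_in[OF play assms(1,2)] by (rule aim_ne_leader)
  have "z t \<in> apart" using play_closure(1)[OF play] assms by simp
  then have safe: "\<beta> * dist ?B ?p + \<rho> \<le> dist (snd (z t)) ?p"
    using aim_in_safe by (simp add: safe_def)
  have "0 < dist ?B ?p" using \<open>?p \<noteq> ?B\<close> by simp
  have "0 < e / \<beta>" using assms speed by simp
  from eventually_small[OF \<open>0 < dist ?B ?p\<close>] leader_slope[OF assms(1,2) this]
  show ?thesis
  proof eventually_elim
    case (elim h)
    have "dist (?B + h *\<^sub>R sgn (?p - ?B)) ?p = dist ?B ?p - h"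
      using elim \<open>?p \<noteq> ?B\<close> by (intro dist_advance) auto
    then have "dist (fst (z (t + h))) ?p \<le> dist ?B ?p - h + e / \<beta> * h"
      using elim(2) dist_triangle[of "fst (z (t + h))" ?p "?B + h *\<^sub>R sgn (?p - ?B)"] by simp
    then have "\<beta> * dist (fst (z (t + h))) ?p \<le> \<beta> * (dist ?B ?p - h + e / \<beta> * h)"
      using speed by (intro mult_left_mono) auto
    also have "\<dots> = \<beta> * dist ?B ?p - \<beta> * h + e * h"
      using speed by (simp add: algebra_simps)
    finally show ?case using safe by linarith
  qed
qed

text \<open>The present aim point stays almost safe: the interceptor, whose speed is \<beta>, can at
  most undo the gain \<beta> h of \<open>leader_closing\<close>.\<close>

lemma leader_miss_antimono:
  assumes "0 \<le> s" "s \<le> T"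
  shows "miss (z T) \<le> miss (z s)"
proof (rule antimono_from_upper_slope[where f = "\<lambda>t. miss (z t)"])
  show "continuous_on {s..T} (\<lambda>t. miss (z t))"
    using play_continuous_miss[OF play] by (rule continuous_on_subset) (use assms in auto)
  fix t e :: real assume t: "s \<le> t" "t < T" "0 < e"
  have "0 < T - t" "0 < e * (\<beta> - 1)" "0 \<le> t" using t speed assms by simp_all
  from eventually_small[OF this(1)] leader_closing[OF this(3) t(2) this(2)]
  show "eventually (\<lambda>h. miss (z (t + h)) \<le> miss (z t) + e * h) (at_right 0)"
  proof eventually_elim
    case (elim h)
    then have C: "\<beta> * dist (fst (z (t + h))) (aim (z t)) + \<rho>
       \<le> dist (snd (z t)) (aim (z t)) - \<beta> * h + e * (\<beta> - 1) * h" by blast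
    have "dist (snd (z t)) (snd (z (t + h))) \<le> \<beta> * h"
      using play_speed(2)[OF play, of t "t + h"] elim t assms by simp
    then have "\<beta> * dist (fst (z (t + h))) (aim (z t)) + \<rho>
       \<le> dist (snd (z (t + h))) (aim (z t)) + e * (\<beta> - 1) * h"
      using C dist_triangle[of "snd (z t)" "aim (z t)" "snd (z (t + h))"] by linarith
    then have "miss (z (t + h)) \<le> dist a (aim (z t)) + e * (\<beta> - 1) * h / (\<beta> - 1)"
      using elim t assms speed play_closure(1)[OF play] by (intro miss_le_near) auto
    then show ?case using speed by (simp add: miss_def)
  qed
qed (use assms in simp)

lemma leader_miss_decreases:
  assumes "0 < T" "0 < miss x" and reg: "regular_law \<rho> \<rho>s a \<gamma>" and ne: "cis (\<gamma> x) \<noteq> sgn (aim x - snd x)"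
  shows "miss (z T) < miss x"
proof -
  let ?p = "aim x" and ?w = "sgn (aim x - snd x)"
  have x: "x \<in> play_states" using play by (simp add: partial_play_def)
  have z0: "z 0 = x" by (rule play_start[OF play])
  have w: "norm ?w = 1"
    using aim_ne_interceptor[OF play_states_apart[OF x]] by (simp add: norm_sgn)
  define g where "g = 1 - cis (\<gamma> x) \<bullet> ?w"
  have "0 < g" using inner_unit_less_1[of "cis (\<gamma> x)" ?w] ne w by (simp add: g_def)
  \<comment> \<open>A heading off by g forgoes \<beta> g h = 4 e h of closing. The first-order
    errors of both players take 2 e h, which leaves a surplus of 2 e h at the old aim point.\<close>
  define e where "e = \<beta> * g / 4"
  have "0 < e" using \<open>0 < g\<close> speed by (simp add: e_def)
  note eventually_small[OF \<open>0 < T\<close>]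
  moreover note leader_closing[OF order_refl \<open>0 < T\<close> \<open>0 < e\<close>, unfolded z0 add_0]
  moreover note play_slope(2)[OF play order_refl \<open>0 < T\<close> \<open>0 < e\<close> reg, unfolded z0 add_0]
  ultimately have "eventually (\<lambda>h. h < T \<and> 0 < h \<and> miss (z h) < miss x) (at_right 0)"
  proof eventually_elim
    case (elim h)
    have "(?p - snd x) \<bullet> ?w - h * ((of_real \<beta> * cis (\<gamma> x)) \<bullet> ?w) - e * h \<le> dist (snd (z h)) ?p"
      by (rule dist_retreat[OF elim(3) w])
    moreover have "(of_real \<beta> * cis (\<gamma> x)) \<bullet> ?w = \<beta> * (1 - g)"
      by (simp add: g_def scaleR_conv_of_real[symmetric])
    ultimately have "dist (snd x) ?p - h * (\<beta> * (1 - g)) - e * h \<le> dist (snd (z h)) ?p"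
      by (simp add: inner_sgn_self dist_norm norm_minus_commute)
    with elim(2) have "\<beta> * dist (fst (z h)) ?p + \<rho> + 2 * e * h \<le> dist (snd (z h)) ?p"
      by (simp add: e_def algebra_simps)
    then have "miss (z h) \<le> max 0 (miss x - 2 * e * h / (\<beta> + 1))"
      unfolding miss_def[of x] using \<open>0 < e\<close> elim by (intro miss_le_deep) auto
    moreover have "0 < 2 * e * h / (\<beta> + 1)" using \<open>0 < e\<close> elim speed by simp
    ultimately show ?case using elim \<open>0 < miss x\<close> by linarith
  qed
  from eventually_happens'[OF trivial_limit_at_right_real this]
  obtain h where h: "h < T" "0 < h" "miss (z h) < miss x" by blast
  have "miss (z T) \<le> miss (z h)" by (rule leader_miss_antimono) (use h in auto)
  with h show ?thesis by linarith
qed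

text \<open>By \<open>aim_progress\<close> the heading makes an angle with the direction of the
  asset whose cosine is at least (\<beta> - 1) / (\<beta> + 1). This rules out endless
  plays.\<close>

lemma leader_time_bound: "dist (fst (z T)) a + (\<beta> - 1) / (\<beta> + 1) * T \<le> dist (fst x) a"
proof -
  define k where "k = (\<beta> - 1) / (\<beta> + 1)"
  have k: "0 < k" "k < 1" using speed by (auto simp: k_def)
  have "0 \<le> T" using play by (simp add: partial_play_def)
  have "dist (fst (z T)) a + k * T \<le> dist (fst (z 0)) a + k * 0"
  proof (rule antimono_from_upper_slope[where f = "\<lambda>t. dist (fst (z t)) a + k * t", OF \<open>0 \<le> T\<close>])
    show "continuous_on {0..T} (\<lambda>t. dist (fst (z t)) a + k * t)"
      by (intro continuous_intros play_continuous[OF play])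
    fix t e :: real assume t: "0 \<le> t" "t < T" "0 < e"
    define B where "B = fst (z t)"
    define L where "L = dist B a"
    define u where "u = sgn (aim (z t) - B)"
    have inplay: "z t \<in> play_states" by (rule play_in[OF play t(1,2)])
    have "0 < L" using inplay zone unfolding L_def B_def play_states_iff by linarith
    have ne: "aim (z t) \<noteq> B" unfolding B_def using inplay by (rule aim_ne_leader)
    have "norm u = 1" using ne by (simp add: u_def norm_sgn)
    have "k * (norm (aim (z t) - B) * L) \<le> (a - B) \<bullet> (aim (z t) - B)"
      using aim_progress[OF play_states_apart[OF inplay]]
      by (simp add: k_def B_def L_def dist_norm norm_minus_commute)
    also have "(a - B) \<bullet> (aim (z t) - B) = norm (aim (z t) - B) * ((a - B) \<bullet> u)"
      using ne by (simp add: u_def sgn_div_norm)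
    finally have ku: "k * L \<le> (a - B) \<bullet> u" using ne by simp
    \<comment> \<open>One half of e absorbs the second-order term of the squared distance, the other
      the deviation from the straight step.\<close>
    define d where "d = e / 2"
    have d: "0 < d" "2 * d = e" using t by (simp_all add: d_def)
    have "0 < min (2 * L * d) L" using \<open>0 < L\<close> d by simp
    from leader_slope[OF t(1,2) \<open>0 < d\<close>] eventually_small[OF this]
    show "eventually (\<lambda>h. dist (fst (z (t + h))) a + k * (t + h)
        \<le> dist (fst (z t)) a + k * t + e * h) (at_right 0)"
    proof eventually_elim
      case (elim h)
      have "(dist (B + h *\<^sub>R u) a)\<^sup>2 = L\<^sup>2 - 2 * h * ((a - B) \<bullet> u) + h\<^sup>2 * (u \<bullet> u)"
        unfolding L_def dist_norm power2_norm_eq_inner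
        by (simp add: algebra_simps inner_commute power2_eq_square)
      also have "\<dots> = L\<^sup>2 - 2 * h * ((a - B) \<bullet> u) + h\<^sup>2"
        using \<open>norm u = 1\<close> by (simp add: norm_eq_1)
      also have "\<dots> \<le> L\<^sup>2 - 2 * h * (k * L) + 2 * L * d * h"
      proof -
        have "2 * h * (k * L) \<le> 2 * h * ((a - B) \<bullet> u)" using elim ku by (intro mult_left_mono) auto
        moreover have "h * h \<le> 2 * L * d * h" using elim by (intro mult_right_mono) auto
        ultimately show ?thesis by (simp add: power2_eq_square)
      qed
      also have "\<dots> \<le> (L - k * h + d * h)\<^sup>2"
        using zero_le_power2[of "d * h - k * h"] by (simp add: power2_eq_square algebra_simps)
      finally have "dist (B + h *\<^sub>R u) a \<le> L - k * h + d * h"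
      proof (rule power2_le_imp_le)
        have "k * h \<le> 1 * h" using k elim by (intro mult_right_mono) auto
        moreover have "0 \<le> d * h" using d elim by simp
        ultimately show "0 \<le> L - k * h + d * h" using elim by linarith
      qed
      then have "dist (fst (z (t + h))) a \<le> L - k * h + 2 * (d * h)"
        using elim(1) dist_triangle[of "fst (z (t + h))" a "B + h *\<^sub>R u"]
        by (simp add: u_def B_def)
      then show ?case by (simp add: L_def B_def algebra_simps flip: d(2))
    qed
  qed
  then show ?thesis by (simp add: k_def play_start[OF play])
qed

end

section \<open>Plays with a homing interceptor\<close>

context
  fixes \<gamma> x z T
  assumes play: "partial_play \<gamma> homing_interceptor x z T"
begin

lemma interceptor_slope:
  assumes "0 \<le> t" "t < T" "0 < e"
  shows "eventually (\<lambda>h. dist (snd (z (t + h))) (snd (z t) + (\<beta> * h) *\<^sub>R sgn (aim (z t) - snd (z t))) \<le> e * h) (at_right 0)"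
proof -
  have "z t \<in> apart" using play_closure(1)[OF play] assms by simp
  then have "h *\<^sub>R (of_real \<beta> * cis (homing_interceptor (z t))) = (\<beta> * h) *\<^sub>R sgn (aim (z t) - snd (z t))" for h
    unfolding cis_homing_interceptor[OF \<open>z t \<in> apart\<close>] by (simp add: scaleR_conv_of_real)
  with play_slope(2)[OF play assms regular_homing_interceptor] show ?thesis by (simp only:)
qed

lemma aim_tendsto:
  assumes "0 \<le> t" "t < T"
  shows "((\<lambda>h. aim (z (t + h))) \<longlongrightarrow> aim (z t)) (at_right 0)"
proof -
  have "continuous_on {t..T} (\<lambda>s. aim (z s))"
    using play_continuous_aim[OF play] by (rule continuous_on_subset) (use assms in auto)
  then have "((\<lambda>s. aim (z s)) \<longlongrightarrow> aim (z t)) (at_right t)"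
    using assms by (auto simp: continuous_on_def at_within_Icc_at_right dest: bspec[of _ _ t])
  then show ?thesis by (subst (asm) filterlim_at_right_to_0) (simp add: add.commute)
qed

text \<open>The target is the later aim point, which the interceptor cannot know at time t; as
  \<open>aim\<close> is continuous along the play, homing on the present one costs only
  o(h).\<close>

lemma interceptor_closing:
  assumes "0 \<le> t" "t < T" "0 < e"
  shows "eventually (\<lambda>h. dist (snd (z (t + h))) (aim (z (t + h)))
    \<le> dist (snd (z t)) (aim (z (t + h))) - \<beta> * h + e * h) (at_right 0)"
proof -
  let ?R = "snd (z t)" and ?w = "sgn (aim (z t) - snd (z t))"
  \<comment> \<open>The error is d h from the straight step and \<beta> h d from the change of
    direction.\<close>
  define d where "d = e / (\<beta> + 1)"
  have d: "0 < d" "(\<beta> + 1) * d = e" using assms speed by (simp_all add: d_def)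
  have "aim (z t) \<noteq> ?R" using aim_ne_interceptor play_closure(1)[OF play] assms by simp
  then have "((\<lambda>h. sgn (aim (z (t + h)) - ?R)) \<longlongrightarrow> ?w) (at_right 0)"
    by (intro tendsto_intros aim_tendsto assms) simp
  then have "eventually (\<lambda>h. dist (sgn (aim (z (t + h)) - ?R)) ?w < d) (at_right 0)"
    using d(1) by (rule tendstoD)
  \<comment> \<open>With \<beta> h below \<rho> / 2 the interceptor cannot overshoot the target,
    which stays at least \<rho> away from it.\<close>
  moreover have "eventually (\<lambda>h. 0 < h \<and> h < min (\<rho> / (2 * \<beta>)) (T - t)) (at_right 0)"
    using range speed assms by (intro eventually_small) simp
  moreover note interceptor_slope[OF assms(1,2) d(1)]
  ultimately show ?thesis
  proof eventually_elim
    case (elim h)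
    let ?Q = "aim (z (t + h))" and ?R' = "snd (z (t + h))"
    have "\<rho> \<le> dist ?R' ?Q"
      using elim assms play_closure(1)[OF play] by (intro interceptor_far aim_in_safe) auto
    moreover have "dist ?R ?R' \<le> \<beta> * h"
      using play_speed(2)[OF play, of t "t + h"] elim assms by simp
    moreover have "2 * (\<beta> * h) < \<rho>"
      using elim speed by (simp add: pos_less_divide_eq mult.commute mult.left_commute)
    moreover have "0 < \<beta> * h" using elim speed by simp
    ultimately have far: "\<beta> * h \<le> dist ?R ?Q" "0 < dist ?R ?Q"
      using dist_triangle[of ?R' ?Q ?R] unfolding dist_commute[of ?R' ?R] by linarith+
    have "dist (?R + (\<beta> * h) *\<^sub>R sgn (?Q - ?R)) ?Q = dist ?R ?Q - \<beta> * h"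
      using far elim speed by (intro dist_advance) auto
    moreover have "dist (?R + (\<beta> * h) *\<^sub>R ?w) (?R + (\<beta> * h) *\<^sub>R sgn (?Q - ?R)) \<le> \<beta> * h * d"
      using elim(1,2) speed
      by (simp add: dist_norm norm_minus_commute less_imp_le flip: scaleR_diff_right)
    ultimately have "dist ?R' ?Q \<le> d * h + \<beta> * h * d + (dist ?R ?Q - \<beta> * h)"
      using elim(3) dist_triangle[of ?R' ?Q "?R + (\<beta> * h) *\<^sub>R ?w"]
        dist_triangle[of "?R + (\<beta> * h) *\<^sub>R ?w" ?Q "?R + (\<beta> * h) *\<^sub>R sgn (?Q - ?R)"] by linarith
    also have "\<dots> = dist ?R ?Q - \<beta> * h + e * h"
      by (simp add: algebra_simps flip: d(2))
    finally show ?case .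
  qed
qed

text \<open>Seen from time t, the later aim point is farther from the interceptor by \<beta> h up to
  o(h), while the leader's scaled distance to it is greater by at most \<beta> h. So it was already
  almost safe at time t, and the earlier \<open>miss\<close> is no larger up to o(h).\<close>

lemma interceptor_miss_mono:
  assumes "0 \<le> s" "s \<le> T"
  shows "miss (z s) \<le> miss (z T)"
proof -
  have "- miss (z T) \<le> - miss (z s)"
  proof (rule antimono_from_upper_slope[where f = "\<lambda>t. - miss (z t)"])
    show "continuous_on {s..T} (\<lambda>t. - miss (z t))"
      by (intro continuous_intros continuous_on_subset[OF play_continuous_miss[OF play]]) (use assms in auto)
    fix t e :: real assume t: "s \<le> t" "t < T" "0 < e"
    have "0 < T - t" "0 < e * (\<beta> - 1)" "0 \<le> t" using t speed assms by simp_all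
    from eventually_small[OF this(1)] interceptor_closing[OF this(3) t(2) this(2)]
    show "eventually (\<lambda>h. - miss (z (t + h)) \<le> - miss (z t) + e * h) (at_right 0)"
    proof eventually_elim
      case (elim h)
      let ?Q = "aim (z (t + h))"
      have C: "dist (snd (z (t + h))) ?Q \<le> dist (snd (z t)) ?Q - \<beta> * h + e * (\<beta> - 1) * h"
        using elim by blast
      have "?Q \<in> safe (z (t + h))"
        using elim t assms play_closure(1)[OF play] by (intro aim_in_safe) auto
      then have "\<beta> * dist (fst (z (t + h))) ?Q + \<rho> \<le> dist (snd (z (t + h))) ?Q"
        by (simp add: safe_def)
      moreover have "dist (fst (z t)) (fst (z (t + h))) \<le> h"
        using play_speed(1)[OF play, of t "t + h"] elim t assms by simp
      then have "\<beta> * dist (fst (z t)) ?Q \<le> \<beta> * (dist (fst (z (t + h))) ?Q + h)"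
        using speed dist_triangle[of "fst (z t)" ?Q "fst (z (t + h))"] by (intro mult_left_mono) auto
      ultimately have "\<beta> * dist (fst (z t)) ?Q + \<rho> \<le> dist (snd (z t)) ?Q + e * (\<beta> - 1) * h"
        using C by (simp add: algebra_simps)
      then have "miss (z t) \<le> dist a ?Q + e * (\<beta> - 1) * h / (\<beta> - 1)"
        using elim t assms speed play_closure(1)[OF play] by (intro miss_le_near) auto
      then show ?case using speed by (simp add: miss_def)
    qed
  qed (use assms in simp)
  then show ?thesis by simp
qed

lemma interceptor_miss_increases:
  assumes "0 < T" "0 < miss x" and reg: "regular_law \<rho> \<rho>s a \<gamma>" and ne: "cis (\<gamma> x) \<noteq> sgn (aim x - fst x)"
  shows "miss x < miss (z T)"
proof -
  let ?u = "sgn (aim x - fst x)" and ?v = "cis (\<gamma> x)"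
  have x: "x \<in> play_states" using play by (simp add: partial_play_def)
  have z0: "z 0 = x" by (rule play_start[OF play])
  have u: "norm ?u = 1"
    using aim_ne_leader[OF x] by (simp add: norm_sgn)
  define g where "g = 1 - ?v \<bullet> ?u"
  have "0 < g" using inner_unit_less_1[of ?v ?u] ne u by (simp add: g_def)
  \<comment> \<open>The wrong heading loses \<beta> g h = 6 \<beta> e h; three errors of size
    \<beta> e h (direction, leader's step, interceptor's step) leave a surplus of 3 \<beta> e h at
    the earlier state.\<close>
  define e where "e = g / 6"
  have "0 < e" and g: "g = 6 * e" using \<open>0 < g\<close> by (simp_all add: e_def)
  have "0 < \<beta> * e" using \<open>0 < e\<close> speed by simp
  note lim = aim_tendsto[OF order_refl \<open>0 < T\<close>, unfolded z0 add_0]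
  have "((\<lambda>h. ?v \<bullet> sgn (aim (z h) - fst x)) \<longlongrightarrow> ?v \<bullet> ?u) (at_right 0)"
    using aim_ne_leader[OF x] by (intro tendsto_intros lim) simp
  then have "eventually (\<lambda>h. ?v \<bullet> sgn (aim (z h) - fst x) < ?v \<bullet> ?u + e) (at_right 0)"
    by (rule order_tendstoD) (use \<open>0 < e\<close> in simp)
  moreover have "eventually (\<lambda>h. aim (z h) \<noteq> fst x) (at_right 0)"
    using tendsto_imp_eventually_ne[OF lim aim_ne_leader[OF x]] .
  moreover note eventually_small[OF \<open>0 < T\<close>]
  moreover note interceptor_closing[OF order_refl \<open>0 < T\<close> \<open>0 < \<beta> * e\<close>, unfolded z0 add_0]
  moreover note play_slope(1)[OF play order_refl \<open>0 < T\<close> \<open>0 < e\<close> reg, unfolded z0 add_0]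
  ultimately have "eventually (\<lambda>h. h < T \<and> 0 < h \<and> miss x < miss (z h)) (at_right 0)"
  proof eventually_elim
    case (elim h)
    let ?Q = "aim (z h)"
    have zh: "z h \<in> apart" using play_closure(1)[OF play] elim by simp
    have "(?Q - fst x) \<bullet> sgn (?Q - fst x) - h * (?v \<bullet> sgn (?Q - fst x)) - e * h \<le> dist (fst (z h)) ?Q"
      using elim(2) by (intro dist_retreat elim(5)) (simp add: norm_sgn)
    moreover have "h * (?v \<bullet> sgn (?Q - fst x)) \<le> h * (1 - g + e)"
      using elim by (intro mult_left_mono) (auto simp: g_def)
    ultimately have "dist (fst x) ?Q \<le> dist (fst (z h)) ?Q + h * (1 - g + e) + e * h"
      by (simp add: inner_sgn_self dist_norm norm_minus_commute)
    then have "\<beta> * dist (fst x) ?Q \<le> \<beta> * (dist (fst (z h)) ?Q + h * (1 - g + e) + e * h)"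
      using speed by (intro mult_left_mono) auto
    moreover have "\<beta> * dist (fst (z h)) ?Q + \<rho> \<le> dist (snd (z h)) ?Q"
      using aim_in_safe[OF zh] by (simp add: safe_def)
    ultimately have "\<beta> * dist (fst x) ?Q + \<rho> + 3 * (\<beta> * e * h) \<le> dist (snd x) ?Q"
      using elim(4) by (simp add: g algebra_simps)
    then have "miss x \<le> max 0 (miss (z h) - 3 * (\<beta> * e * h) / (\<beta> + 1))"
      unfolding miss_def[of "z h"] using \<open>0 < e\<close> elim speed by (intro miss_le_deep) auto
    moreover have "0 < 3 * (\<beta> * e * h) / (\<beta> + 1)" using \<open>0 < e\<close> elim speed by simp
    ultimately show ?case using elim \<open>0 < miss x\<close> by linarith
  qed
  from eventually_happens'[OF trivial_limit_at_right_real this]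
  obtain h where h: "h < T" "0 < h" "miss x < miss (z h)" by blast
  have "miss (z h) \<le> miss (z T)" by (rule interceptor_miss_mono) (use h in auto)
  with h show ?thesis by linarith
qed

end

end

section \<open>Saddle points\<close>

context blocking_game
begin

text \<open>Endless plays are excluded by \<open>leader_time_bound\<close>. At the end the payoff is
  \<rho>s if the zone is reached and \<open>miss (z T)\<close> if the leader is blocked; the maximum
  covers both.\<close>

lemma payoff_homing_leader:
  assumes x: "x \<in> play_states" and w: "w \<in> payoffs \<beta> \<rho> \<rho>s a homing_leader \<gamma> x"
  obtains z T where "partial_play homing_leader \<gamma> x z T" "0 < T" "w \<le> ereal (max \<rho>s (miss (z T)))"
proof -
  consider z T where "terminating_play \<beta> \<rho> \<rho>s a homing_leader \<gamma> x z T" "w = ereal (dist (fst (z T)) a)"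
    | z where "endless_play \<beta> \<rho> \<rho>s a homing_leader \<gamma> x z"
    using w unfolding payoffs_def by blast
  then show thesis
  proof cases
    case 1
    then have play: "partial_play homing_leader \<gamma> x z T" and fin: "z T \<in> terminal \<rho> \<rho>s a"
      using x by (auto intro: partial_play_of_terminating simp: terminating_play_def)
    have "z T \<noteq> x" using fin x by (auto simp: terminal_def playing_def)
    then have "0 < T"
      using play_start[OF play] play by (cases "T = 0") (auto simp: partial_play_def)
    have "dist (fst (z T)) a = \<rho>s \<or> dist (fst (z T)) a = miss (z T)"
      using fin miss_at_blocking[of "z T"] by (auto simp: terminal_def dist_commute)
    then have "w \<le> ereal (max \<rho>s (miss (z T)))"
      unfolding 1(2) ereal_less_eq(3) by linarith
    with play \<open>0 < T\<close> show thesis by (rule that)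
  next
    case 2
    define k where "k = (\<beta> - 1) / (\<beta> + 1)"
    \<comment> \<open>Later than the time at which an approach at rate k would have used up the
      whole initial distance.\<close>
    define T where "T = dist (fst x) a / k + 1"
    have k: "0 < k" using speed by (simp add: k_def)
    then have "0 \<le> T" unfolding T_def by (intro add_nonneg_nonneg divide_nonneg_pos) auto
    from leader_time_bound[OF partial_play_of_endless[OF 2 x this], folded k_def]
    have "k * T \<le> dist (fst x) a"
      using zero_le_dist[of "fst (z T)" a] by linarith
    moreover have "k * T = dist (fst x) a + k"
      using k by (simp add: T_def distrib_left)
    ultimately show thesis using k by linarith
  qed
qed

lemma payoff_homing_interceptor:
  assumes x: "x \<in> play_states" and w: "w \<in> payoffs \<beta> \<rho> \<rho>s a \<gamma> homing_interceptor x" "w \<noteq> \<infinity>"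
  obtains z T where "partial_play \<gamma> homing_interceptor x z T" "0 < T" "ereal (miss (z T)) \<le> w"
proof -
  obtain z T where 1: "terminating_play \<beta> \<rho> \<rho>s a \<gamma> homing_interceptor x z T" "w = ereal (dist (fst (z T)) a)"
    using w unfolding payoffs_def by blast
  then have play: "partial_play \<gamma> homing_interceptor x z T" and fin: "z T \<in> terminal \<rho> \<rho>s a"
    using x by (auto intro: partial_play_of_terminating simp: terminating_play_def)
  have "z T \<noteq> x" using fin x by (auto simp: terminal_def playing_def)
  then have "0 < T"
    using play_start[OF play] play by (cases "T = 0") (auto simp: partial_play_def)
  moreover have "ereal (miss (z T)) \<le> w"
    unfolding 1(2) ereal_less_eq(3) using miss_le_dist[OF play_closure(1)[OF play, of T]] \<open>0 < T\<close>
    by (simp add: dist_commute)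
  ultimately show thesis using play that by blast
qed

lemma leader_guarantee:
  assumes x: "x \<in> play_states" and w: "w \<in> payoffs \<beta> \<rho> \<rho>s a homing_leader \<gamma> x"
  shows "w \<le> ereal (max \<rho>s (miss x))"
proof -
  obtain z T where play: "partial_play homing_leader \<gamma> x z T" "0 < T" "w \<le> ereal (max \<rho>s (miss (z T)))"
    using payoff_homing_leader[OF x w] .
  have "miss (z T) \<le> miss x"
    using leader_miss_antimono[OF play(1), of 0] play(2) by (simp add: play_start[OF play(1)])
  then have "ereal (max \<rho>s (miss (z T))) \<le> ereal (max \<rho>s (miss x))"
    unfolding ereal_less_eq(3) by linarith
  with play(3) show ?thesis by (rule order_trans)
qed

lemma interceptor_guarantee:
  assumes x: "x \<in> play_states" and w: "w \<in> payoffs \<beta> \<rho> \<rho>s a \<gamma> homing_interceptor x"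
  shows "ereal (miss x) \<le> w"
proof (cases "w = \<infinity>")
  case False
  then obtain z T where play: "partial_play \<gamma> homing_interceptor x z T" "0 < T" "ereal (miss (z T)) \<le> w"
    using payoff_homing_interceptor[OF x w] by blast
  have "miss x \<le> miss (z T)"
    using interceptor_miss_mono[OF play(1), of 0] play(2) by (simp add: play_start[OF play(1)])
  then show ?thesis using play(3) by (metis ereal_less_eq(3) order_trans)
qed simp

lemma homing_saddle_point:
  assumes x: "x \<in> play_states" and miss: "\<rho>s < miss x"
  shows "saddle_point \<beta> \<rho> \<rho>s a homing_leader homing_interceptor x"
proof -
  have upper: "w \<le> ereal (miss x)" if "w \<in> payoffs \<beta> \<rho> \<rho>s a homing_leader \<gamma> x" for w \<gamma>
    using leader_guarantee[OF x that] miss by (simp add: max_def split: if_splits)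
  then have "w = ereal (miss x)" if "w \<in> payoffs \<beta> \<rho> \<rho>s a homing_leader homing_interceptor x" for w
    using interceptor_guarantee[OF x that] that by (blast intro: antisym)
  moreover have "payoffs \<beta> \<rho> \<rho>s a homing_leader homing_interceptor x \<noteq> {}"
    using x by (intro payoffs_nonempty regular_homing_leader regular_homing_interceptor)
  ultimately have "payoffs \<beta> \<rho> \<rho>s a homing_leader homing_interceptor x = {ereal (miss x)}" by blast
  then show ?thesis
    unfolding saddle_point_def
    using regular_homing_leader regular_homing_interceptor upper interceptor_guarantee[OF x] by blast
qed

text \<open>A blocked play ends outside the zone, so the value of the saddle point exceeds \<rho>s.
  The leader could deviate to homing, which yields at most the maximum of \<rho>s and
  \<open>miss x\<close>; hence that maximum exceeds \<rho>s.\<close>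

lemma red_winning_miss:
  assumes "x \<in> red_winning \<beta> \<rho> \<rho>s a"
  shows "x \<in> play_states" "\<rho>s < miss x"
proof -
  show x: "x \<in> play_states" using assms by (simp add: red_winning_def)
  obtain \<gamma>B \<gamma>R z T where sp: "saddle_point \<beta> \<rho> \<rho>s a \<gamma>B \<gamma>R x"
    and play: "terminating_play \<beta> \<rho> \<rho>s a \<gamma>B \<gamma>R x z T" and blocked: "z T \<in> blocked \<rho> \<rho>s a"
    using assms unfolding red_winning_def by blast
  obtain v where v: "payoffs \<beta> \<rho> \<rho>s a \<gamma>B \<gamma>R x = {v}"
    and lower: "\<And>\<gamma> w. feedback_law \<gamma> \<Longrightarrow> w \<in> payoffs \<beta> \<rho> \<rho>s a \<gamma> \<gamma>R x \<Longrightarrow> v \<le> w"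
    and reg: "regular_law \<rho> \<rho>s a \<gamma>R"
    using sp unfolding saddle_point_def by blast
  have "ereal (dist (fst (z T)) a) \<in> payoffs \<beta> \<rho> \<rho>s a \<gamma>B \<gamma>R x"
    using play unfolding payoffs_def by blast
  then have "v = ereal (dist (fst (z T)) a)" unfolding v by simp
  moreover have "\<rho>s < dist (fst (z T)) a"
    using blocked unfolding blocked_def by (cases "z T") simp
  ultimately have "ereal \<rho>s < v" by simp
  obtain w where w: "w \<in> payoffs \<beta> \<rho> \<rho>s a homing_leader \<gamma>R x"
    using payoffs_nonempty[OF regular_homing_leader reg x] by blast
  have "v \<le> w" using w regular_homing_leader by (intro lower) (auto simp: regular_law_def)
  also have "w \<le> ereal (max \<rho>s (miss x))" by (rule leader_guarantee[OF x w])
  finally have "ereal \<rho>s < ereal (max \<rho>s (miss x))"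
    by (rule order.strict_trans2[OF \<open>ereal \<rho>s < v\<close>])
  then show "\<rho>s < miss x" unfolding less_ereal.simps(1) by linarith
qed

text \<open>Each law of the saddle point is played against the opponent's homing law. With payoffs
  w1 and w2 of these plays, \<open>miss x \<le> w1 \<le> v \<le> w2 \<le> miss x\<close>, so all are
  equal, whereas a wrong initial heading would make the first or the last inequality strict.\<close>

lemma saddle_point_headings:
  assumes x: "x \<in> play_states" and miss: "\<rho>s < miss x"
    and sp: "saddle_point \<beta> \<rho> \<rho>s a \<gamma>B \<gamma>R x"
  shows "cis (\<gamma>B x) = sgn (aim x - fst x)" "cis (\<gamma>R x) = sgn (aim x - snd x)"
proof -
  have "0 < miss x" using miss zone by simp
  obtain v where lower: "\<And>\<gamma> w. feedback_law \<gamma> \<Longrightarrow> w \<in> payoffs \<beta> \<rho> \<rho>s a \<gamma> \<gamma>R x \<Longrightarrow> v \<le> w"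
    and upper: "\<And>\<gamma> w. feedback_law \<gamma> \<Longrightarrow> w \<in> payoffs \<beta> \<rho> \<rho>s a \<gamma>B \<gamma> x \<Longrightarrow> w \<le> v"
    and reg: "regular_law \<rho> \<rho>s a \<gamma>B" "regular_law \<rho> \<rho>s a \<gamma>R"
    using sp unfolding saddle_point_def by blast
  obtain w1 where w1: "w1 \<in> payoffs \<beta> \<rho> \<rho>s a \<gamma>B homing_interceptor x"
    using payoffs_nonempty[OF reg(1) regular_homing_interceptor x] by blast
  obtain w2 where w2: "w2 \<in> payoffs \<beta> \<rho> \<rho>s a homing_leader \<gamma>R x"
    using payoffs_nonempty[OF regular_homing_leader reg(2) x] by blast
  have "w1 \<le> v" using w1 regular_homing_interceptor by (intro upper) (auto simp: regular_law_def)
  have "v \<le> w2" using w2 regular_homing_leader by (intro lower) (auto simp: regular_law_def)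
  have "w1 \<le> ereal (miss x)"
    using \<open>w1 \<le> v\<close> \<open>v \<le> w2\<close> leader_guarantee[OF x w2] miss by (simp add: max_def split: if_splits)
  have "ereal (miss x) \<le> w2"
    using \<open>w1 \<le> v\<close> \<open>v \<le> w2\<close> interceptor_guarantee[OF x w1] by simp
  show "cis (\<gamma>B x) = sgn (aim x - fst x)"
  proof (rule ccontr)
    assume ne: "\<not> ?thesis"
    obtain z T where play: "partial_play \<gamma>B homing_interceptor x z T" "0 < T" "ereal (miss (z T)) \<le> w1"
      using payoff_homing_interceptor[OF x w1] \<open>w1 \<le> ereal (miss x)\<close> by (metis PInfty_neq_ereal(1) ereal_infty_less_eq(1))
    have "miss x < miss (z T)"
      by (rule interceptor_miss_increases[OF play(1,2) \<open>0 < miss x\<close> reg(1) ne])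
    with play(3) \<open>w1 \<le> ereal (miss x)\<close> show False
      by (metis ereal_less_eq(3) linorder_not_le order_trans)
  qed
  show "cis (\<gamma>R x) = sgn (aim x - snd x)"
  proof (rule ccontr)
    assume ne: "\<not> ?thesis"
    obtain z T where play: "partial_play homing_leader \<gamma>R x z T" "0 < T" "w2 \<le> ereal (max \<rho>s (miss (z T)))"
      using payoff_homing_leader[OF x w2] .
    have "miss (z T) < miss x"
      by (rule leader_miss_decreases[OF play(1,2) \<open>0 < miss x\<close> reg(2) ne])
    with miss have "max \<rho>s (miss (z T)) < miss x" by simp
    with play(3) \<open>ereal (miss x) \<le> w2\<close> show False
      by (metis ereal_less_eq(3) linorder_not_le order_trans)
  qed
qed

text \<open>The vector under \<open>cnj\<close> is half the gradient, at the aim point, of the left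
  side of \<open>safe_iff\<close>; a vanishing imaginary part says that it is parallel to the
  direction of the asset.\<close>

lemma aim_normal:
  assumes x: "x \<in> play_states"
  defines "k \<equiv> (\<beta>\<^sup>2 - 1) + \<beta> * \<rho> / dist (fst x) (aim x)"
  shows "Im ((a - aim x) * cnj (k *\<^sub>R (aim x - fst x) + (snd x - fst x))) = 0"
proof -
  define N where "N = a - aim x"
  define u where "u = aim x - fst x"
  define w where "w = snd x - fst x"
  define G where "G = k *\<^sub>R u + w"
  have "u \<noteq> 0" using aim_ne_leader[OF x] by (simp add: u_def)
  \<comment> \<open>Along a direction in which the gradient falls one stays in the safe region, so
    such a direction cannot lead closer to the asset.\<close>
  have descent: "N \<bullet> v \<le> 0" if v: "G \<bullet> v < 0" for v
  proof -
    define q where "q t = u \<bullet> u + 2 * t * (u \<bullet> v) + t\<^sup>2 * (v \<bullet> v)" for t :: real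
    define n where "n t = sqrt (q t)" for t
    define f where "f t = (\<beta>\<^sup>2 - 1) * q t + 2 * \<beta> * \<rho> * n t + 2 * ((u + t *\<^sub>R v) \<bullet> w)" for t
    have q: "q t = (norm (u + t *\<^sub>R v))\<^sup>2" for t
      unfolding q_def power2_norm_eq_inner by (simp add: algebra_simps inner_commute power2_eq_square)
    have "q 0 > 0" using \<open>u \<noteq> 0\<close> by (simp add: q_def)
    have dq: "(q has_real_derivative 2 * (u \<bullet> v)) (at 0)"
      unfolding q_def by (auto intro!: derivative_eq_intros)
    have dn: "(n has_real_derivative (2 * (u \<bullet> v)) * (inverse (n 0) / 2)) (at 0)"
      using DERIV_chain2[OF DERIV_real_sqrt[OF \<open>q 0 > 0\<close>] dq] by (simp add: n_def[abs_def] mult.commute)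
    have df: "(f has_real_derivative (\<beta>\<^sup>2 - 1) * (2 * (u \<bullet> v))
        + 2 * \<beta> * \<rho> * ((2 * (u \<bullet> v)) * (inverse (n 0) / 2)) + 2 * (v \<bullet> w)) (at 0)"
      unfolding f_def inner_add_left inner_scaleR_left by (auto intro!: derivative_eq_intros dq dn)
    have n0: "n 0 = dist (fst x) (aim x)"
      by (simp add: n_def q u_def dist_norm norm_minus_commute)
    have "(\<beta>\<^sup>2 - 1) * (2 * (u \<bullet> v))
        + 2 * \<beta> * \<rho> * ((2 * (u \<bullet> v)) * (inverse (n 0) / 2)) + 2 * (v \<bullet> w) = 2 * (G \<bullet> v)"
      unfolding n0 G_def k_def inner_add_left inner_scaleR_left inner_commute[of v w] divide_inverse
      by (simp add: algebra_simps)
    from DERIV_cong[OF df this] have "(f has_real_derivative 2 * (G \<bullet> v)) (at 0)" .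
    from DERIV_neg_dec_right[OF this] v obtain d where d: "d > 0" "\<And>h. 0 < h \<Longrightarrow> h < d \<Longrightarrow> f h < f 0"
      by auto
    define t where "t = d / 2"
    have "t > 0" and t: "f t < f 0" using d(1) d(2)[of "d / 2"] by (simp_all add: t_def)
    have f_safe: "f s \<le> (dist (fst x) (snd x))\<^sup>2 - \<rho>\<^sup>2 \<longleftrightarrow> aim x + s *\<^sub>R v \<in> safe x" for s
    proof -
      have shift: "aim x + s *\<^sub>R v - fst x = u + s *\<^sub>R v" by (simp add: u_def)
      then show ?thesis unfolding safe_iff f_def n_def q w_def shift by simp
    qed
    have "aim x \<in> safe x" using x by (intro aim_in_safe play_states_apart)
    then have "f 0 \<le> (dist (fst x) (snd x))\<^sup>2 - \<rho>\<^sup>2" using f_safe[of 0] by simp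
    then have "aim x + t *\<^sub>R v \<in> safe x" using t f_safe[of t] by simp
    from closest_point_dot[OF convex_safe closed_safe this, of a]
    have "t * (N \<bullet> v) \<le> 0" by (simp add: aim_def N_def)
    then show ?thesis using \<open>t > 0\<close> by (simp add: mult_le_0_iff)
  qed
  \<comment> \<open>A tangential direction is a limit of descending ones, obtained by subtracting a
    small multiple of G; both signs of c give orthogonality to the tangent.\<close>
  have side: "N \<bullet> (c *\<^sub>R (\<i> * G)) \<le> 0" for c
  proof (cases "G = 0")
    case False
    let ?v = "c *\<^sub>R (\<i> * G)"
    have orth: "G \<bullet> (\<i> * G) = 0" by (simp add: inner_complex_def)
    show ?thesis
    proof (rule field_le_epsilon)
      fix e :: real assume "e > 0"
      define \<delta> where "\<delta> = e / (\<bar>N \<bullet> G\<bar> + 1)"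
      have "\<delta> > 0" using \<open>e > 0\<close> by (simp add: \<delta>_def)
      have "\<delta> * (N \<bullet> G) \<le> \<delta> * (\<bar>N \<bullet> G\<bar> + 1)" using \<open>\<delta> > 0\<close> by (intro mult_left_mono) auto
      then have "\<delta> * (N \<bullet> G) \<le> e" by (simp add: \<delta>_def)
      moreover have "N \<bullet> (?v - \<delta> *\<^sub>R G) \<le> 0"
        using False \<open>\<delta> > 0\<close> by (intro descent) (simp add: inner_diff_right orth)
      ultimately show "N \<bullet> ?v \<le> 0 + e" by (simp add: inner_diff_right)
    qed
  qed simp
  have "N \<bullet> (\<i> * G) = 0" using side[of 1] side[of "-1"] by simp
  then show ?thesis
    unfolding N_def G_def u_def w_def by (simp add: inner_complex_def algebra_simps)
qed

end

section \<open>The relative frame and the sextic\<close>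

text \<open>
  Here \<open>m\<close> stands for \<open>x\<^sub>1' / d\<^sub>s\<close> and \<open>S\<close> for the squared sine of the relative angle; the
  squared cosine has been replaced by \<open>1 - S\<close>, which turns the claim into a polynomial identity.
\<close>

lemma sextic_identity:
  fixes m X \<beta> \<rho> r c S :: real
  shows "((1 - S) * ((\<beta>\<^sup>2 - 1) * r + \<beta> * \<rho>)\<^sup>2 + 2 * c * ((\<beta>\<^sup>2 - 1) * r + \<beta> * \<rho>) * (m * r) + (m * r)\<^sup>2)
      * (4 * X\<^sup>2 * r\<^sup>2 - ((1 - \<beta>\<^sup>2) * r\<^sup>2 - 2 * \<beta> * \<rho> * r - (\<rho>\<^sup>2 - X\<^sup>2))\<^sup>2)
    - S * (((\<beta>\<^sup>2 - 1) * r + \<beta> * \<rho>) * ((1 - \<beta>\<^sup>2) * r\<^sup>2 - 2 * \<beta> * \<rho> * r - (\<rho>\<^sup>2 - X\<^sup>2)) + 2 * X\<^sup>2 * r)\<^sup>2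
   = - ((1 - \<beta>\<^sup>2)^2 * ((1 - \<beta>\<^sup>2)^2 + m * (m - 2 * ((1 - \<beta>\<^sup>2) * c))) * r ^ 6
     + (- 2 * (1 - \<beta>\<^sup>2) * \<beta> * \<rho> * (3 * (1 - \<beta>\<^sup>2)^2 + m * (2 * m - 5 * ((1 - \<beta>\<^sup>2) * c)))) * r ^ 5
     + (\<beta>^2 * \<rho>^2 * (13 * (1 - \<beta>\<^sup>2)^2 + 4 * m * (m - 4 * ((1 - \<beta>\<^sup>2) * c)))
              - 2 * ((1 - \<beta>\<^sup>2) * (\<rho>\<^sup>2 - X\<^sup>2) + 2 * X^2) * ((1 - \<beta>\<^sup>2)^2 + m * (m - 2 * ((1 - \<beta>\<^sup>2) * c)))) * r ^ 4
     + (4 * \<beta> * \<rho> * (\<beta>^2 * \<rho>^2 * (2 * m * c - 3 * (1 - \<beta>\<^sup>2))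
              + (1 - \<beta>\<^sup>2) * (\<rho>\<^sup>2 - X\<^sup>2) * (2 * (1 - \<beta>\<^sup>2) - 3 * m * c)
              + (m\<^sup>2 * (\<rho>\<^sup>2 - X\<^sup>2) + X^2 * ((1 - \<beta>\<^sup>2) * (2 + S) - 2 * m * c)))) * r ^ 3
     + (2 * \<beta>^2 * \<rho>^2 * (2 * \<beta>^2 * \<rho>^2 - 2 * X^2 * (1 + S) + (\<rho>\<^sup>2 - X\<^sup>2) * (4 * m * c - 5 * (1 - \<beta>\<^sup>2)))
              + (\<rho>\<^sup>2 - X\<^sup>2)^2 * ((1 - \<beta>\<^sup>2)^2 + m * (m - 2 * ((1 - \<beta>\<^sup>2) * c)))
              + 4 * X^2 * S * (X^2 + (1 - \<beta>\<^sup>2) * (\<rho>\<^sup>2 - X\<^sup>2))) * r ^ 2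
     + (4 * \<beta> * \<rho> * ((\<rho>\<^sup>2 - X\<^sup>2) * (\<beta>^2 * \<rho>^2 - X^2 * S) + 1/2 * (\<rho>\<^sup>2 - X\<^sup>2)^2 * (m * c - (1 - \<beta>\<^sup>2)))) * r
     + (\<beta> * \<rho> * (\<rho>\<^sup>2 - X\<^sup>2))^2)"
  by algebra
context blocking_game
begin

definition rel :: "state \<Rightarrow> complex \<Rightarrow> complex" where
  "rel x P = (P - fst x) * cis (- los_angle x)"

text \<open>The law of cosines for distances r to the leader and \<beta> r + \<rho> to the
  interceptor. Where the sine vanishes the sign is 1 and not \<open>asset_side\<close>, which is 0
  there and would in general put the point off the oval.\<close>

definition oval_point :: "state \<Rightarrow> real \<Rightarrow> complex" where
  "oval_point x r = Complex (quad \<beta> \<rho> x r / (2 * rel_x1 x))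
     ((if sin (rel_angle a x) < 0 then -1 else 1) * sqrt (radicand \<beta> \<rho> x r) / (2 * rel_x1 x))"

lemma rel_leader: "rel x (fst x) = 0"
  by (simp add: rel_def)

lemma norm_rel_diff: "norm (rel x P - rel x Q) = dist P Q"
proof -
  have "rel x P - rel x Q = (P - Q) * cis (- los_angle x)"
    by (simp add: rel_def algebra_simps)
  then show ?thesis by (simp add: norm_mult dist_norm)
qed

lemma norm_rel: "norm (rel x P) = dist (fst x) P"
  using norm_rel_diff[of x P "fst x"] by (simp add: rel_leader dist_commute)

lemma rel_surj: obtains P where "rel x P = q"
proof
  show "rel x (fst x + q * cis (los_angle x)) = q"
    by (simp add: rel_def mult.assoc cis_mult)
qed

lemma rel_interceptor:
  assumes "x \<in> apart"
  shows "rel x (snd x) = of_real (rel_x1 x)"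
proof -
  have "snd x - fst x = of_real (norm (snd x - fst x)) * cis (Arg (snd x - fst x))"
    using rcis_cmod_Arg[of "snd x - fst x"] by (simp add: rcis_def)
  then have "rel x (snd x) = of_real (norm (snd x - fst x)) * (cis (Arg (snd x - fst x)) * cis (- Arg (snd x - fst x)))"
    unfolding rel_def los_angle_def by (simp add: case_prod_beta mult.assoc)
  then show ?thesis by (simp add: cis_mult rel_x1_def case_prod_beta dist_norm)
qed

lemma rel_asset: "rel x a = of_real (asset_dist a x) * cis (rel_angle a x)"
proof -
  have "a - fst x = of_real (norm (a - fst x)) * cis (Arg (a - fst x))"
    using rcis_cmod_Arg[of "a - fst x"] by (simp add: rcis_def)
  then have "rel x a = of_real (norm (a - fst x)) * (cis (Arg (a - fst x)) * cis (- los_angle x))"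
    unfolding rel_def by (simp add: mult.assoc)
  then show ?thesis by (simp add: cis_mult rel_angle_def asset_dist_def case_prod_beta dist_norm)
qed

lemma rel_x1_pos: "x \<in> apart \<Longrightarrow> 0 < rel_x1 x"
  using range by (auto simp: apart_def rel_x1_def case_prod_beta dist_commute)

lemma safe_iff_rel:
  assumes "x \<in> apart"
  shows "P \<in> safe x \<longleftrightarrow> \<beta> * norm (rel x P) + \<rho> \<le> norm (rel x P - of_real (rel_x1 x))"
  using norm_rel_diff[of x P "snd x"] by (simp add: rel_interceptor[OF assms] safe_def norm_rel dist_commute)

lemma norm_minus_real_power2: "(norm (q - of_real X))\<^sup>2 = (norm q)\<^sup>2 - 2 * X * Re q + X\<^sup>2"
  unfolding cmod_power2 by (simp add: power2_eq_square algebra_simps)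

lemma oval_point_on_oval:
  assumes x: "x \<in> apart" and r: "0 < r" "0 \<le> radicand \<beta> \<rho> x r"
  shows "norm (oval_point x r) = r" "norm (oval_point x r - of_real (rel_x1 x)) = \<beta> * r + \<rho>"
proof -
  define X where "X = rel_x1 x"
  have "0 < X" using rel_x1_pos[OF x] by (simp add: X_def)
  have "(norm (oval_point x r))\<^sup>2 = ((quad \<beta> \<rho> x r)\<^sup>2 + radicand \<beta> \<rho> x r) / (4 * X\<^sup>2)"
    unfolding cmod_power2 oval_point_def using r(2)
    by (simp add: power_divide power_mult_distrib add_divide_distrib X_def)
  also have "\<dots> = r\<^sup>2"
    using \<open>0 < X\<close> by (simp add: radicand_def X_def)
  finally have n2: "(norm (oval_point x r))\<^sup>2 = r\<^sup>2" .
  then show n: "norm (oval_point x r) = r" using r(1) by (simp add: power2_eq_iff_nonneg)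
  have "(norm (oval_point x r - of_real X))\<^sup>2 = r\<^sup>2 - quad \<beta> \<rho> x r + X\<^sup>2"
    unfolding norm_minus_real_power2 n2 using \<open>0 < X\<close> by (simp add: oval_point_def X_def)
  also have "\<dots> = (\<beta> * r + \<rho>)\<^sup>2"
    by (simp add: quad_def X_def power2_eq_square algebra_simps)
  finally show "norm (oval_point x r - of_real (rel_x1 x)) = \<beta> * r + \<rho>"
    using r(1) speed range by (simp add: power2_eq_iff_nonneg X_def)
qed

lemma side_times_sin: "asset_side a x * sin (rel_angle a x) = \<bar>sin (rel_angle a x)\<bar>"
  if "0 < asset_dist a x"
  using that by (simp add: asset_side_def sgn_mult sgn_pos abs_sgn mult.commute)

lemma cost_eq_dist:
  assumes x: "x \<in> play_states" and r: "0 < r" "0 \<le> radicand \<beta> \<rho> x r"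
  shows "cost \<beta> \<rho> a x r = (norm (rel x a - oval_point x r))\<^sup>2"
proof -
  define X where "X = rel_x1 x"
  define d where "d = asset_dist a x"
  define \<phi> where "\<phi> = rel_angle a x"
  define q where "q = oval_point x r"
  have X: "0 < X" using rel_x1_pos[OF play_states_apart[OF x]] by (simp add: X_def)
  have "0 < d" using x zone by (auto simp: play_states_iff asset_dist_def case_prod_beta dist_commute d_def)
  \<comment> \<open>The two sign conventions differ only at sine 0, where the factor
    \<open>sin \<phi>\<close> hides the difference.\<close>
  then have side: "asset_side a x * sin \<phi> = (if sin \<phi> < 0 then -1 else 1) * sin \<phi>"
    unfolding \<phi>_def d_def by (subst side_times_sin) auto
  have "(norm (rel x a - q))\<^sup>2 = (norm (rel x a))\<^sup>2 + (norm q)\<^sup>2 - 2 * (Re (rel x a) * Re q + Im (rel x a) * Im q)"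
    unfolding cmod_power2 by (simp add: power2_eq_square algebra_simps)
  also have "norm (rel x a) = d" using \<open>0 < d\<close> by (simp add: rel_asset norm_mult d_def)
  also have "norm q = r" using oval_point_on_oval(1)[OF play_states_apart[OF x] r] by (simp add: q_def)
  also have "2 * (Re (rel x a) * Re q + Im (rel x a) * Im q) = d / X * (cos \<phi> * quad \<beta> \<rho> x r
      + (if sin \<phi> < 0 then -1 else 1) * sin \<phi> * sqrt (radicand \<beta> \<rho> x r))"
    using X by (simp add: rel_asset q_def oval_point_def d_def \<phi>_def X_def field_simps)
  finally show ?thesis
    unfolding side[symmetric] by (simp add: cost_def d_def X_def \<phi>_def q_def)
qed

lemma rel_aim_on_oval:
  assumes x: "x \<in> play_states" and miss: "0 < miss x"
  defines "r \<equiv> dist (fst x) (aim x)"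
  shows "0 < r" "0 \<le> radicand \<beta> \<rho> x r" "2 * rel_x1 x * Re (rel x (aim x)) = quad \<beta> \<rho> x r"
    "(2 * rel_x1 x * Im (rel x (aim x)))\<^sup>2 = radicand \<beta> \<rho> x r"
proof -
  define X where "X = rel_x1 x"
  define p where "p = rel x (aim x)"
  have ap: "x \<in> apart" using x by (rule play_states_apart)
  show "0 < r" using aim_ne_leader[OF x] by (simp add: r_def)
  have "norm p = r" by (simp add: p_def norm_rel r_def)
  have "norm (p - of_real X) = \<beta> * r + \<rho>"
    using aim_on_boundary[OF ap miss] norm_rel_diff[of x "aim x" "snd x"]
    by (simp add: p_def X_def rel_interceptor[OF ap] r_def dist_commute)
  then have "(\<beta> * r + \<rho>)\<^sup>2 = r\<^sup>2 - 2 * X * Re p + X\<^sup>2"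
    using norm_minus_real_power2[of p X] \<open>norm p = r\<close> by simp
  then have re: "2 * X * Re p = quad \<beta> \<rho> x r"
    by (simp add: quad_def X_def power2_eq_square algebra_simps)
  then show "2 * rel_x1 x * Re (rel x (aim x)) = quad \<beta> \<rho> x r" by (simp add: X_def p_def)
  have "(2 * X * Im p)\<^sup>2 = 4 * X\<^sup>2 * (norm p)\<^sup>2 - (2 * X * Re p)\<^sup>2"
    unfolding cmod_power2 by (simp add: power2_eq_square algebra_simps)
  then show "(2 * rel_x1 x * Im (rel x (aim x)))\<^sup>2 = radicand \<beta> \<rho> x r"
    unfolding \<open>norm p = r\<close> re by (simp add: radicand_def X_def p_def)
  then show "0 \<le> radicand \<beta> \<rho> x r" by (metis zero_le_power2)
qed

text \<open>The safe region is symmetric about the line of sight, and the mirror image of the aim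
  point cannot be closer to the asset. If the asset lies on that line, both are equally close and
  coincide by uniqueness.\<close>

lemma rel_aim_side:
  assumes x: "x \<in> play_states"
  shows "0 \<le> sin (rel_angle a x) * Im (rel x (aim x))"
    and "sin (rel_angle a x) = 0 \<Longrightarrow> Im (rel x (aim x)) = 0"
proof -
  define p where "p = rel x (aim x)"
  have ap: "x \<in> apart" using x by (rule play_states_apart)
  have d: "0 < asset_dist a x"
    using x zone by (auto simp: play_states_iff asset_dist_def case_prod_beta dist_commute)
  obtain P where P: "rel x P = cnj p" by (rule rel_surj)
  have "norm (cnj p - of_real (rel_x1 x)) = norm (p - of_real (rel_x1 x))"
    by (metis complex_cnj_complex_of_real complex_cnj_diff complex_mod_cnj)
  then have "P \<in> safe x"
    using aim_in_safe[OF ap] by (simp add: safe_iff_rel[OF ap] P p_def)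
  have "(norm (rel x a - cnj p))\<^sup>2 - (norm (rel x a - p))\<^sup>2 = 4 * (Im (rel x a) * Im p)"
    unfolding cmod_power2 by (simp add: power2_eq_square algebra_simps)
  then have diff: "(dist a P)\<^sup>2 - (miss x)\<^sup>2 = 4 * asset_dist a x * (sin (rel_angle a x) * Im p)"
    using norm_rel_diff[of x a P] norm_rel_diff[of x a "aim x"]
    by (simp add: P p_def miss_def rel_asset)
  have "(miss x)\<^sup>2 \<le> (dist a P)\<^sup>2"
    using miss_le[OF \<open>P \<in> safe x\<close>] miss_nonneg by (intro power_mono) auto
  with diff have "0 \<le> (4 * asset_dist a x) * (sin (rel_angle a x) * Im p)" by linarith
  then show "0 \<le> sin (rel_angle a x) * Im (rel x (aim x))"
    using d by (simp add: zero_le_mult_iff p_def)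
  assume "sin (rel_angle a x) = 0"
  with diff have "dist a P = miss x" using miss_nonneg by (simp add: power2_eq_iff_nonneg)
  then have "P = aim x" using \<open>P \<in> safe x\<close> by (intro aim_unique) auto
  with P have "cnj p = p" by (simp add: p_def)
  then show "Im (rel x (aim x)) = 0" by (simp add: p_def complex_eq_iff)
qed

text \<open>The first equation has the sign of \<open>oval_point\<close>, the second the sign
  \<zeta> of the heading formulas. Where they differ the sine vanishes, and the imaginary part is 0
  by \<open>rel_aim_side\<close>.\<close>

lemma rel_aim_eq_oval_point:
  assumes x: "x \<in> play_states" and miss: "0 < miss x"
  shows "rel x (aim x) = oval_point x (dist (fst x) (aim x))"
    and "Im (rel x (aim x)) = asset_side a x * sqrt (radicand \<beta> \<rho> x (dist (fst x) (aim x))) / (2 * rel_x1 x)"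
proof -
  define X where "X = rel_x1 x"
  define p where "p = rel x (aim x)"
  define s where "s = sin (rel_angle a x)"
  define rt where "rt = sqrt (radicand \<beta> \<rho> x (dist (fst x) (aim x)))"
  have X: "0 < X" using rel_x1_pos[OF play_states_apart[OF x]] by (simp add: X_def)
  have d: "0 < asset_dist a x"
    using x zone by (auto simp: play_states_iff asset_dist_def case_prod_beta dist_commute)
  have "\<bar>2 * X * Im p\<bar> = rt"
    unfolding rt_def rel_aim_on_oval(4)[OF x miss, symmetric] by (simp add: X_def p_def)
  then have abs: "2 * X * \<bar>Im p\<bar> = rt" using X by (simp add: abs_mult)
  have re: "Re p = quad \<beta> \<rho> x (dist (fst x) (aim x)) / (2 * X)"
    using rel_aim_on_oval(3)[OF x miss] X by (simp add: p_def X_def field_simps)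
  have side: "0 \<le> s * Im p" "s = 0 \<Longrightarrow> Im p = 0"
    using rel_aim_side[OF x] by (simp_all add: s_def p_def)
  have "Im p = (if s < 0 then -1 else 1) * \<bar>Im p\<bar>"
    using side by (cases s "0 :: real" rule: linorder_cases) (auto simp: zero_le_mult_iff)
  then have im: "Im p = (if s < 0 then -1 else 1) * rt / (2 * X)"
    using abs X by (auto simp: field_simps)
  show "rel x (aim x) = oval_point x (dist (fst x) (aim x))"
    using re im by (simp add: complex_eq_iff oval_point_def p_def X_def s_def rt_def)
  show "Im (rel x (aim x)) = asset_side a x * sqrt (radicand \<beta> \<rho> x (dist (fst x) (aim x))) / (2 * rel_x1 x)"
    using im side(2) d
    by (cases s "0 :: real" rule: linorder_cases)
      (auto simp: asset_side_def sgn_mult p_def X_def s_def rt_def)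
qed

text \<open>
  At the aim point the normal of the oval is parallel to the direction towards the asset; squaring
  this relation removes the square root and yields the sextic.
\<close>

lemma sextic_aim:
  assumes x: "x \<in> play_states" and miss: "0 < miss x"
  shows "sextic \<beta> \<rho> a x (dist (fst x) (aim x)) = 0"
proof -
  define r where "r = dist (fst x) (aim x)"
  define X where "X = rel_x1 x"
  define d where "d = asset_dist a x"
  define c where "c = cos (rel_angle a x)"
  define s where "s = sin (rel_angle a x)"
  define p where "p = rel x (aim x)"
  define k where "k = (\<beta>\<^sup>2 - 1) + \<beta> * \<rho> / r"
  define \<kappa> where "\<kappa> = (\<beta>\<^sup>2 - 1) * r + \<beta> * \<rho>"
  define Q where "Q = quad \<beta> \<rho> x r"
  define m where "m = X / d"
  note oval = rel_aim_on_oval[OF x miss, folded r_def X_def p_def Q_def]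
  have d: "0 < d"
    using x zone by (auto simp: play_states_iff asset_dist_def case_prod_beta dist_commute d_def)
  have kr: "k * r = \<kappa>" using oval(1) by (simp add: k_def \<kappa>_def field_simps)
  define L where "L = los_angle x"
  \<comment> \<open>Rotating both factors by the same angle leaves the product with the conjugate
    unchanged, so \<open>aim_normal\<close> passes to the relative frame.\<close>
  have "(a - aim x) * cnj (k *\<^sub>R (aim x - fst x) + (snd x - fst x))
      = (rel x a - p) * cnj (k *\<^sub>R p + rel x (snd x))"
  proof -
    have "(rel x a - p) * cnj (k *\<^sub>R p + rel x (snd x))
        = (a - aim x) * cnj (k *\<^sub>R (aim x - fst x) + (snd x - fst x)) * (cis (- L) * cnj (cis (- L)))"
      by (simp add: p_def rel_def L_def scaleR_conv_of_real algebra_simps)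
    then show ?thesis by (simp add: cis_cnj cis_mult)
  qed
  then have "Im ((rel x a - p) * cnj (k *\<^sub>R p + of_real X)) = 0"
    using aim_normal[OF x] rel_interceptor[OF play_states_apart[OF x]]
    by (simp add: k_def r_def X_def)
  then have "(d * s - Im p) * (k * Re p + X) = (d * c - Re p) * (k * Im p)"
    by (simp add: rel_asset d_def s_def c_def algebra_simps)
  then have "(d * c * k + X) * Im p = d * s * (k * Re p + X)"
    by (simp add: algebra_simps)
  \<comment> \<open>The factor r clears the denominator in k. The factor 2 X introduced below turns
    the real part into \<open>quad\<close> and, after squaring, the imaginary part into
    \<open>radicand\<close>.\<close>
  then have "r * ((d * c * k + X) * Im p) = r * (d * s * (k * Re p + X))" by simp
  then have "(d * c * (k * r) + X * r) * Im p = d * s * ((k * r) * Re p + X * r)"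
    by (simp add: algebra_simps)
  then have "2 * X * ((d * c * \<kappa> + X * r) * Im p) = 2 * X * (d * s * (\<kappa> * Re p + X * r))"
    unfolding kr by simp
  then have "(d * c * \<kappa> + X * r) * (2 * X * Im p) = d * s * (\<kappa> * (2 * X * Re p) + 2 * X\<^sup>2 * r)"
    by (simp add: power2_eq_square algebra_simps)
  moreover have "d * c * \<kappa> + X * r = d * (c * \<kappa> + m * r)" using d by (simp add: m_def algebra_simps)
  ultimately have "(c * \<kappa> + m * r) * (2 * X * Im p) = s * (\<kappa> * Q + 2 * X\<^sup>2 * r)"
    using d unfolding oval(3) by (simp add: mult.assoc)
  then have "(c * \<kappa> + m * r)\<^sup>2 * (2 * X * Im p)\<^sup>2 = s\<^sup>2 * (\<kappa> * Q + 2 * X\<^sup>2 * r)\<^sup>2"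
    by (metis power_mult_distrib)
  then have "(c\<^sup>2 * \<kappa>\<^sup>2 + 2 * c * \<kappa> * (m * r) + (m * r)\<^sup>2) * radicand \<beta> \<rho> x r
      - s\<^sup>2 * (\<kappa> * Q + 2 * X\<^sup>2 * r)\<^sup>2 = 0"
    unfolding oval(4) by (simp add: power2_eq_square algebra_simps)
  moreover have "c\<^sup>2 = 1 - s\<^sup>2" by (simp add: c_def s_def cos_squared_eq)
  ultimately have zero: "((1 - s\<^sup>2) * \<kappa>\<^sup>2 + 2 * c * \<kappa> * (m * r) + (m * r)\<^sup>2) * radicand \<beta> \<rho> x r
      - s\<^sup>2 * (\<kappa> * Q + 2 * X\<^sup>2 * r)\<^sup>2 = 0" by simp
  \<comment> \<open>The coefficient of \<open>r^3\<close> contains \<eta> / \<open>d^2\<close>, the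
    only place in the sextic where d occurs outside X / d.\<close>
  have md: "X\<^sup>2 * (y / d\<^sup>2 + u - v) = m\<^sup>2 * y + X\<^sup>2 * (u - v)" for y u v
    by (simp add: m_def power_divide algebra_simps)
  have "sextic \<beta> \<rho> a x r = - (((1 - s\<^sup>2) * \<kappa>\<^sup>2 + 2 * c * \<kappa> * (m * r) + (m * r)\<^sup>2) * radicand \<beta> \<rho> x r
      - s\<^sup>2 * (\<kappa> * Q + 2 * X\<^sup>2 * r)\<^sup>2)"
    unfolding sextic_def Let_def radicand_def Q_def quad_def \<kappa>_def X_def[symmetric] d_def[symmetric]
      c_def[symmetric] s_def[symmetric] sextic_identity m_def[symmetric] minus_minus
    by (simp only: md)
  then show ?thesis unfolding zero by (simp add: r_def)
qed

text \<open>Squaring may give the sextic further positive roots. They do no harm: every positive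
  radius with nonnegative radicand belongs to a safe point, so its cost is at least
  \<open>(miss x)\<^sup>2\<close>, with equality only at the aim point.\<close>

lemma optimal_radius_iff:
  assumes x: "x \<in> play_states" and miss: "0 < miss x"
  shows "optimal_radius \<beta> \<rho> a x r \<longleftrightarrow> r = dist (fst x) (aim x)"
proof -
  define r0 where "r0 = dist (fst x) (aim x)"
  have ap: "x \<in> apart" using x by (rule play_states_apart)
  note oval = rel_aim_on_oval[OF x miss, folded r0_def]
  have cost0: "cost \<beta> \<rho> a x r0 = (miss x)\<^sup>2"
    using cost_eq_dist[OF x oval(1,2)] rel_aim_eq_oval_point(1)[OF x miss, folded r0_def]
      norm_rel_diff[of x a "aim x"]
    by (simp add: miss_def)
  have opt: "(miss x)\<^sup>2 \<le> cost \<beta> \<rho> a x r" "cost \<beta> \<rho> a x r \<le> (miss x)\<^sup>2 \<Longrightarrow> r = r0"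
    if r: "0 < r" "0 \<le> radicand \<beta> \<rho> x r" for r
  proof -
    obtain P where P: "rel x P = oval_point x r" by (rule rel_surj)
    have safe: "P \<in> safe x"
      using oval_point_on_oval[OF ap r] by (simp add: safe_iff_rel[OF ap] P)
    have cost: "cost \<beta> \<rho> a x r = (dist a P)\<^sup>2"
      using cost_eq_dist[OF x r] norm_rel_diff[of x a P] by (simp add: P)
    show "(miss x)\<^sup>2 \<le> cost \<beta> \<rho> a x r"
      unfolding cost using miss_le[OF safe] miss_nonneg by (intro power_mono) auto
    assume "cost \<beta> \<rho> a x r \<le> (miss x)\<^sup>2"
    then have "dist a P \<le> miss x" unfolding cost using miss_nonneg by (rule power2_le_imp_le)
    with safe have "P = aim x" by (rule aim_unique)
    then show "r = r0"
      using oval_point_on_oval(1)[OF ap r] norm_rel[of x "aim x"] P by (simp add: r0_def)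
  qed
  have "r0 > 0 \<and> radicand \<beta> \<rho> x r0 \<ge> 0 \<and> sextic \<beta> \<rho> a x r0 = 0"
    using oval(1,2) sextic_aim[OF x miss] by (simp add: r0_def)
  then show ?thesis
    unfolding optimal_radius_def is_arg_min_def r0_def[symmetric] using opt cost0
    by (metis linorder_not_less)
qed

lemma optimal_headings:
  assumes x: "x \<in> play_states" and miss: "\<rho>s < miss x"
    and sp: "saddle_point \<beta> \<rho> \<rho>s a \<gamma>B \<gamma>R x"
  defines "p \<equiv> rel x (aim x)"
  shows "cis (\<gamma>B x - los_angle x) = sgn p" "cis (\<gamma>R x - los_angle x) = sgn (p - of_real (rel_x1 x))"
proof -
  have rot: "sgn (P - Q) * cis (- los_angle x) = sgn (rel x P - rel x Q)" for P Q
  proof -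
    have "rel x P - rel x Q = (P - Q) * cis (- los_angle x)"
      by (simp add: rel_def algebra_simps)
    then show ?thesis by (simp add: sgn_mult)
  qed
  have "cis (\<gamma> - los_angle x) = cis \<gamma> * cis (- los_angle x)" for \<gamma>
    by (simp add: cis_mult)
  then show "cis (\<gamma>B x - los_angle x) = sgn p" "cis (\<gamma>R x - los_angle x) = sgn (p - of_real (rel_x1 x))"
    using saddle_point_headings[OF x miss sp] rot[of "aim x"] rel_interceptor[OF play_states_apart[OF x]]
    by (simp_all add: p_def rel_leader)
qed

end

theorem theorem3:
  fixes \<beta> \<rho> \<rho>s :: real and a :: complex
  assumes "\<beta> > 1" and "\<rho> > 0" and "\<rho>s > 0"
  shows
    "(\<forall>x \<in> red_winning \<beta> \<rho> \<rho>s a. \<exists>!r. optimal_radius \<beta> \<rho> a x r) \<and>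
     (\<exists>\<gamma>B \<gamma>R. \<forall>x \<in> red_winning \<beta> \<rho> \<rho>s a. saddle_point \<beta> \<rho> \<rho>s a \<gamma>B \<gamma>R x) \<and>
     (\<forall>x \<in> red_winning \<beta> \<rho> \<rho>s a. \<forall>\<gamma>B \<gamma>R r.
        saddle_point \<beta> \<rho> \<rho>s a \<gamma>B \<gamma>R x \<longrightarrow> optimal_radius \<beta> \<rho> a x r \<longrightarrow>
        (let b = 1 - \<beta>^2; \<eta> = \<rho>^2 - (rel_x1 x)^2;
             cos\<theta> = (b * r^2 - 2 * \<beta> * \<rho> * r - \<eta>) / (2 * rel_x1 x * r);
             sin\<theta> = sqrt (4 * (rel_x1 x)^2 * r^2 - (b * r^2 - 2 * \<beta> * \<rho> * r - \<eta>)^2) / (2 * rel_x1 x * r);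
             xs = r * cos\<theta>;
             ys = asset_side a x * r * sin\<theta>;
             \<theta>B = \<gamma>B x - los_angle x;
             \<theta>R = \<gamma>R x - los_angle x
         in cos \<theta>B = xs / sqrt (xs^2 + ys^2) \<and>
            sin \<theta>B = ys / sqrt (xs^2 + ys^2) \<and>
            cos \<theta>R = (xs - rel_x1 x) / sqrt ((xs - rel_x1 x)^2 + ys^2) \<and>
            sin \<theta>R = ys / sqrt ((xs - rel_x1 x)^2 + ys^2)))"
proof -
  interpret blocking_game \<beta> \<rho> \<rho>s a
    using assms by unfold_locales
  show ?thesis
  proof (intro conjI ballI allI impI)
    fix x assume "x \<in> red_winning \<beta> \<rho> \<rho>s a"
    note win = red_winning_miss[OF this]
    then have "0 < miss x" using zone by simp
    then show "\<exists>!r. optimal_radius \<beta> \<rho> a x r"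
      using optimal_radius_iff[OF win(1)] by simp
  next
    show "\<exists>\<gamma>B \<gamma>R. \<forall>x \<in> red_winning \<beta> \<rho> \<rho>s a. saddle_point \<beta> \<rho> \<rho>s a \<gamma>B \<gamma>R x"
      using homing_saddle_point[OF red_winning_miss] by blast
  next
    fix x \<gamma>B \<gamma>R r
    assume "x \<in> red_winning \<beta> \<rho> \<rho>s a" and sp: "saddle_point \<beta> \<rho> \<rho>s a \<gamma>B \<gamma>R x"
      and opt: "optimal_radius \<beta> \<rho> a x r"
    note win = red_winning_miss[OF \<open>x \<in> red_winning \<beta> \<rho> \<rho>s a\<close>]
    have "0 < miss x" using win zone by simp
    define X where "X = rel_x1 x"
    define p where "p = rel x (aim x)"
    have X: "0 < X" using rel_x1_pos[OF play_states_apart[OF win(1)]] by (simp add: X_def)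
    have r: "r = dist (fst x) (aim x)" using opt optimal_radius_iff[OF win(1) \<open>0 < miss x\<close>] by simp
    have "0 < r" unfolding r by (rule rel_aim_on_oval(1)[OF win(1) \<open>0 < miss x\<close>])
    have re: "Re p = r * (((1 - \<beta>\<^sup>2) * r\<^sup>2 - 2 * \<beta> * \<rho> * r - (\<rho>\<^sup>2 - X\<^sup>2)) / (2 * X * r))"
      using rel_aim_on_oval(3)[OF win(1) \<open>0 < miss x\<close>, folded r p_def X_def, symmetric] X \<open>0 < r\<close>
      unfolding quad_def X_def[symmetric] by simp
    have im: "Im p = asset_side a x * r *
        (sqrt (4 * X\<^sup>2 * r\<^sup>2 - ((1 - \<beta>\<^sup>2) * r\<^sup>2 - 2 * \<beta> * \<rho> * r - (\<rho>\<^sup>2 - X\<^sup>2))\<^sup>2) / (2 * X * r))"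
      using rel_aim_eq_oval_point(2)[OF win(1) \<open>0 < miss x\<close>, folded r] X \<open>0 < r\<close>
      by (simp add: p_def X_def quad_def radicand_def)
    note headings = optimal_headings[OF win sp, folded p_def X_def]
    have "cos (\<gamma>B x - los_angle x) = Re p / sqrt ((Re p)\<^sup>2 + (Im p)\<^sup>2)"
      "sin (\<gamma>B x - los_angle x) = Im p / sqrt ((Re p)\<^sup>2 + (Im p)\<^sup>2)"
      using arg_cong[OF headings(1), of Re] arg_cong[OF headings(1), of Im]
      by (simp_all add: cmod_def)
    moreover have "cos (\<gamma>R x - los_angle x) = (Re p - X) / sqrt ((Re p - X)\<^sup>2 + (Im p)\<^sup>2)"
      "sin (\<gamma>R x - los_angle x) = Im p / sqrt ((Re p - X)\<^sup>2 + (Im p)\<^sup>2)"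
      using arg_cong[OF headings(2), of Re] arg_cong[OF headings(2), of Im]
      by (simp_all add: cmod_def)
    ultimately show "let b = 1 - \<beta>^2; \<eta> = \<rho>^2 - (rel_x1 x)^2;
               cos\<theta> = (b * r^2 - 2 * \<beta> * \<rho> * r - \<eta>) / (2 * rel_x1 x * r);
               sin\<theta> = sqrt (4 * (rel_x1 x)^2 * r^2 - (b * r^2 - 2 * \<beta> * \<rho> * r - \<eta>)^2) / (2 * rel_x1 x * r);
               xs = r * cos\<theta>;
               ys = asset_side a x * r * sin\<theta>;
               \<theta>B = \<gamma>B x - los_angle x;
               \<theta>R = \<gamma>R x - los_angle x
           in cos \<theta>B = xs / sqrt (xs^2 + ys^2) \<and>
              sin \<theta>B = ys / sqrt (xs^2 + ys^2) \<and>
              cos \<theta>R = (xs - rel_x1 x) / sqrt ((xs - rel_x1 x)^2 + ys^2) \<and>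
              sin \<theta>R = ys / sqrt ((xs - rel_x1 x)^2 + ys^2)"
      unfolding Let_def X_def[symmetric] re[symmetric] im[symmetric] by blast
  qed
qed

end
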